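(* Let $\Omega\subset\mathbb{R}^d$ be compact and convex with a non-negligible interior. Take $\mu,\nu\in\mathcal{P}(\Omega)$ with $\mu\ll\mathcal{L}_d$. Suppose $\lambda_0>0$ is given. For each $n\ge0$, set $\lambda_{n+1}=\lambda_n/2$ and define $$\nu_{n+1}:=\operatorname*{arg\,min}_{\rho\in\mathcal{P}(\Omega)}\ \frac12W_2^2(\rho,\mu)+\lambda_nW_1(\rho,\nu_n),$$ where $\nu_0:=\nu$. Then: 1. The sequence $\nu_n$ converges to $\mu$ with rate $$\frac12W_2^2(\mu,\nu_n)\le2^{-2n+1}\lambda_0^2\qquad(n\ge1).$$ 2. The following energy equality holds: $$\frac12W_2^2(\nu,\mu)=\sum_{n=0}^\infty\Big(D_{\lambda_n}(\nu_n,\nu_{n+1})+\lambda_nW_1(\nu_n,\nu_{n+1})\Big).$$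
   Context: $\mathcal{P}(\Omega)$ is the set of Borel probability measures on $\Omega$, $\mathcal{L}_d$ is Lebesgue measure, and $W_p$ is the Wasserstein $p$ distance for the Euclidean distance. The minimizer defining $\nu_{n+1}$ exists and is unique because $\mu\ll\mathcal{L}_d$. $\lambda\text{-Lip}(\Omega)$ is the set of functions on $\Omega$ with Lipschitz constant at most $\lambda$. With $\mu$ the fixed reference measure, for $\lambda>0$ and $\sigma,\rho\in\mathcal{P}(\Omega)$, $$D_\lambda(\sigma,\rho)=\tfrac12W_2^2(\sigma,\mu)-\tfrac12W_2^2(\rho,\mu)-\sup\Big\{\int_\Omega\varphi\,d(\sigma-\rho)\ \Big|\ \varphi\in\partial\big(\tfrac12W_2^2(\cdot,\mu)\big)(\rho)\cap\lambda\text{-Lip}(\Omega)\Big\},$$ with $\sup\emptyset=-\infty$. Here $\frac12W_2^2(\cdot,\mu)$ is viewed as a convex functional on the finite signed Borel measures $\mathcal{M}(\Omega)=C(\Omega)^*$, equal to $+\infty$ off $\mathcal{P}(\Omega)$, and its subdifferential is taken in $C(\Omega)$; equivalently $\varphi\in\partial\big(\frac12W_2^2(\cdot,\mu)\big)(\rho)$ iff $\varphi\in C(\Omega)$ and $\int_\Omega\varphi^{c_2}\,d\mu+\int_\Omega\varphi\,d\rho=\frac12W_2^2(\mu,\rho)$, where $\varphi^{c_2}(x)=\inf_{y\in\Omega}\big(\frac12|x-y|^2-\varphi(y)\big)$. *)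

theory Defs
  imports "HOL-Probability.Probability"
begin

definition prob_measures :: "'a::euclidean_space set \<Rightarrow> 'a measure set" where
  "prob_measures \<Omega> = {\<sigma>. prob_space \<sigma> \<and> sets \<sigma> = sets (restrict_space borel \<Omega>)}"

definition couplings :: "'a measure \<Rightarrow> 'a measure \<Rightarrow> ('a \<times> 'a) measure set" where
  "couplings \<sigma> \<rho> =
     {\<gamma>. sets \<gamma> = sets (\<sigma> \<Otimes>\<^sub>M \<rho>) \<and> distr \<gamma> \<sigma> fst = \<sigma> \<and> distr \<gamma> \<rho> snd = \<rho>}"

text \<open>Only meaningful for probability measures with finite \<open>p\<close>-th moments, in particular for
  those on a bounded set: otherwise the Bochner integral takes its default value \<open>0\<close>.\<close>

definition wasserstein ::
  "real \<Rightarrow> 'a::euclidean_space measure \<Rightarrow> 'a measure \<Rightarrow> real" where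
  "wasserstein p \<sigma> \<rho> =
     (INF \<gamma>\<in>couplings \<sigma> \<rho>. \<integral>z. dist (fst z) (snd z) powr p \<partial>\<gamma>) powr (1 / p)"

text \<open>A finite signed Borel measure on \<open>\<Omega>\<close> is represented by its set function, extended by \<open>0\<close>
  to non-measurable sets; every one is a difference of two finite measures by the Jordan
  decomposition. A probability measure \<open>\<sigma>\<close> corresponds to the set function \<open>measure \<sigma>\<close>.\<close>

definition finite_measures :: "'a::euclidean_space set \<Rightarrow> 'a measure set" where
  "finite_measures \<Omega> = {\<alpha>. finite_measure \<alpha> \<and> sets \<alpha> = sets (restrict_space borel \<Omega>)}"

definition signed_measures :: "'a::euclidean_space set \<Rightarrow> ('a set \<Rightarrow> real) set" where
  "signed_measures \<Omega> =
     {measure \<alpha> - measure \<beta> | \<alpha> \<beta>. \<alpha> \<in> finite_measures \<Omega> \<and> \<beta> \<in> finite_measures \<Omega>}"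

text \<open>The value does not depend on the decomposition of \<open>m\<close>; see \<open>signed_integral_diff\<close>.\<close>

definition signed_integral ::
  "'a::euclidean_space set \<Rightarrow> ('a set \<Rightarrow> real) \<Rightarrow> ('a \<Rightarrow> real) \<Rightarrow> real" where
  "signed_integral \<Omega> m \<phi> =
     (THE r. \<exists>\<alpha>\<in>finite_measures \<Omega>. \<exists>\<beta>\<in>finite_measures \<Omega>.
        m = measure \<alpha> - measure \<beta> \<and> r = (\<integral>x. \<phi> x \<partial>\<alpha>) - (\<integral>x. \<phi> x \<partial>\<beta>))"

lemma finite_measures_nn_integral_eq:
  fixes \<phi> :: "'a::euclidean_space \<Rightarrow> ennreal"
  assumes fin: "\<alpha> \<in> finite_measures \<Omega>" "\<beta> \<in> finite_measures \<Omega>"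
      "\<alpha>' \<in> finite_measures \<Omega>" "\<beta>' \<in> finite_measures \<Omega>"
    and eq: "measure \<alpha> - measure \<beta> = measure \<alpha>' - measure \<beta>'"
    and \<phi>: "\<phi> \<in> borel_measurable (restrict_space borel \<Omega>)"
  shows "nn_integral \<alpha> \<phi> + nn_integral \<beta>' \<phi> = nn_integral \<alpha>' \<phi> + nn_integral \<beta> \<phi>"
proof -
  have s: "sets \<alpha> = sets (restrict_space borel \<Omega>)" "sets \<beta> = sets (restrict_space borel \<Omega>)"
    "sets \<alpha>' = sets (restrict_space borel \<Omega>)" "sets \<beta>' = sets (restrict_space borel \<Omega>)"
    and f: "finite_measure \<alpha>" "finite_measure \<beta>" "finite_measure \<alpha>'" "finite_measure \<beta>'"
    using fin by (auto simp: finite_measures_def)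
  have sp: "space \<alpha> = space (restrict_space borel \<Omega>)" "space \<beta> = space (restrict_space borel \<Omega>)"
    "space \<alpha>' = space (restrict_space borel \<Omega>)" "space \<beta>' = space (restrict_space borel \<Omega>)"
    using s[THEN sets_eq_imp_space_eq] by auto
  have m: "f \<in> borel_measurable \<alpha>" "f \<in> borel_measurable \<beta>"
      "f \<in> borel_measurable \<alpha>'" "f \<in> borel_measurable \<beta>'"
    if "f \<in> borel_measurable (restrict_space borel \<Omega>)" for f :: "'a \<Rightarrow> ennreal"
    using that s by (metis measurable_cong_sets)+
  show ?thesis
    using \<phi>
  proof (induction rule: borel_measurable_induct)
    case (cong f g)
    have "nn_integral \<kappa> f = nn_integral \<kappa> g" if "space \<kappa> = space (restrict_space borel \<Omega>)" for \<kappa>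
      using cong.hyps(3) that by (intro nn_integral_cong) auto
    then show ?case using cong.IH sp by simp
  next
    case (set A)
    have "measure \<alpha> A + measure \<beta>' A = measure \<alpha>' A + measure \<beta> A"
      using fun_cong[OF eq, of A] by simp
    then have "ennreal (measure \<alpha> A) + ennreal (measure \<beta>' A)
             = ennreal (measure \<alpha>' A) + ennreal (measure \<beta> A)"
      by (simp flip: ennreal_plus)
    then show ?case
      using set f by (simp add: s finite_measure.emeasure_eq_measure)
  next
    case (mult u c)
    show ?case
      unfolding nn_integral_cmult[OF m(1)[OF mult.hyps(2)]] nn_integral_cmult[OF m(2)[OF mult.hyps(2)]]
        nn_integral_cmult[OF m(3)[OF mult.hyps(2)]] nn_integral_cmult[OF m(4)[OF mult.hyps(2)]]
      using mult.IH by (metis distrib_left)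
  next
    case (add u v)
    have swap: "(a + b) + (c + d) = (a + c) + (b + d)" for a b c d :: ennreal
      by (simp only: ac_simps)
    show ?case
      unfolding nn_integral_add[OF m(1)[OF add.hyps(3)] m(1)[OF add.hyps(1)]]
        nn_integral_add[OF m(2)[OF add.hyps(3)] m(2)[OF add.hyps(1)]]
        nn_integral_add[OF m(3)[OF add.hyps(3)] m(3)[OF add.hyps(1)]]
        nn_integral_add[OF m(4)[OF add.hyps(3)] m(4)[OF add.hyps(1)]]
      using add.IH by (metis swap)
  next
    case (seq U)
    have inc: "incseq (\<lambda>i. nn_integral \<kappa> (U i))" for \<kappa>
      using seq.hyps(3) by (auto simp: incseq_def le_fun_def intro!: nn_integral_mono)
    have sup: "nn_integral \<kappa> (Sup (range U)) = (SUP i. nn_integral \<kappa> (U i))"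
      if "\<And>i. U i \<in> borel_measurable \<kappa>" for \<kappa>
    proof -
      have "Sup (range U) = (\<lambda>x. SUP i. U i x)"
        by (simp add: fun_eq_iff image_comp)
      then show ?thesis
        using nn_integral_monotone_convergence_SUP[OF seq.hyps(3) that] by simp
    qed
    note sups = sup[OF m(1)[OF seq.hyps(1)]] sup[OF m(2)[OF seq.hyps(1)]]
      sup[OF m(3)[OF seq.hyps(1)]] sup[OF m(4)[OF seq.hyps(1)]]
    show ?case
      unfolding sups ennreal_SUP_add[OF inc inc, symmetric] by (simp only: seq.IH)
  qed
qed

lemma signed_integral_diff:
  fixes \<phi> :: "'a::euclidean_space \<Rightarrow> real"
  assumes \<Omega>: "compact \<Omega>" and \<phi>: "continuous_on \<Omega> \<phi>"
    and fin: "\<alpha> \<in> finite_measures \<Omega>" "\<beta> \<in> finite_measures \<Omega>"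
  shows "signed_integral \<Omega> (measure \<alpha> - measure \<beta>) \<phi> = (\<integral>x. \<phi> x \<partial>\<alpha>) - (\<integral>x. \<phi> x \<partial>\<beta>)"
proof -
  have meas: "\<phi> \<in> borel_measurable (restrict_space borel \<Omega>)"
    by (rule borel_measurable_continuous_on_restrict[OF \<phi>])
  obtain B where B: "\<And>x. x \<in> \<Omega> \<Longrightarrow> norm (\<phi> x) \<le> B"
    using compact_imp_bounded[OF compact_continuous_image[OF \<phi> \<Omega>]]
    unfolding bounded_iff by auto
  have int: "integrable \<kappa> \<phi>" if "\<kappa> \<in> finite_measures \<Omega>" for \<kappa>
  proof -
    from that have s: "sets \<kappa> = sets (restrict_space borel \<Omega>)" and f: "finite_measure \<kappa>"
      by (auto simp: finite_measures_def)
    have "space \<kappa> = \<Omega>"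
      using sets_eq_imp_space_eq[OF s] by (simp add: space_restrict_space)
    then show ?thesis
      using B meas by (intro finite_measure.integrable_const_bound[OF f, of _ B])
        (auto simp: measurable_cong_sets[OF s refl])
  qed
  have unique: "(\<integral>x. \<phi> x \<partial>\<alpha>) - (\<integral>x. \<phi> x \<partial>\<beta>) = (\<integral>x. \<phi> x \<partial>\<alpha>') - (\<integral>x. \<phi> x \<partial>\<beta>')"
    if fin': "\<alpha>' \<in> finite_measures \<Omega>" "\<beta>' \<in> finite_measures \<Omega>"
      and eq: "measure \<alpha> - measure \<beta> = measure \<alpha>' - measure \<beta>'" for \<alpha>' \<beta>'
  proof -
    have key: "enn2real (nn_integral \<alpha> h) + enn2real (nn_integral \<beta>' h)
             = enn2real (nn_integral \<alpha>' h) + enn2real (nn_integral \<beta> h)"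
      if "h = (\<lambda>x. ennreal (\<phi> x)) \<or> h = (\<lambda>x. ennreal (- \<phi> x))" for h
    proof -
      have "h \<in> borel_measurable (restrict_space borel \<Omega>)"
        using that meas by auto
      from finite_measures_nn_integral_eq[OF fin fin' eq this]
      have "nn_integral \<alpha> h + nn_integral \<beta>' h = nn_integral \<alpha>' h + nn_integral \<beta> h" .
      moreover have "nn_integral \<kappa> h < top" if "\<kappa> \<in> finite_measures \<Omega>" for \<kappa>
        using int[OF that] \<open>h = _ \<or> h = _\<close>
        by (auto simp: real_integrable_def less_top)
      ultimately show ?thesis
        using fin fin' by (metis enn2real_plus)
    qed
    show ?thesis
      using key[of "\<lambda>x. ennreal (\<phi> x)"] key[of "\<lambda>x. ennreal (- \<phi> x)"]
      by (simp add: real_lebesgue_integral_def int fin fin')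
  qed
  show ?thesis
    unfolding signed_integral_def
  proof (rule the_equality)
    show "\<exists>\<alpha>'\<in>finite_measures \<Omega>. \<exists>\<beta>'\<in>finite_measures \<Omega>.
        measure \<alpha> - measure \<beta> = measure \<alpha>' - measure \<beta>' \<and>
        (\<integral>x. \<phi> x \<partial>\<alpha>) - (\<integral>x. \<phi> x \<partial>\<beta>) = (\<integral>x. \<phi> x \<partial>\<alpha>') - (\<integral>x. \<phi> x \<partial>\<beta>')"
      using fin by blast
  next
    fix r
    assume "\<exists>\<alpha>'\<in>finite_measures \<Omega>. \<exists>\<beta>'\<in>finite_measures \<Omega>.
        measure \<alpha> - measure \<beta> = measure \<alpha>' - measure \<beta>' \<and>
        r = (\<integral>x. \<phi> x \<partial>\<alpha>') - (\<integral>x. \<phi> x \<partial>\<beta>')"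
    then obtain \<alpha>' \<beta>' where "\<alpha>' \<in> finite_measures \<Omega>" "\<beta>' \<in> finite_measures \<Omega>"
      "measure \<alpha> - measure \<beta> = measure \<alpha>' - measure \<beta>'"
      and r: "r = (\<integral>x. \<phi> x \<partial>\<alpha>') - (\<integral>x. \<phi> x \<partial>\<beta>')"
      by blast
    from unique[OF this(1-3)] r show "r = (\<integral>x. \<phi> x \<partial>\<alpha>) - (\<integral>x. \<phi> x \<partial>\<beta>)"
      by (rule trans[OF _ sym, rotated])
  qed
qed

text \<open>The subdifferential, taken in \<open>C(\<Omega>)\<close>, of an extended-real functional \<open>F\<close> on the finite
  signed measures. Since \<open>\<phi>\<close> is a function on the whole space, only its restriction to \<open>\<Omega>\<close>
  matters.\<close>

definition subdifferential ::
  "'a::euclidean_space set \<Rightarrow> (('a set \<Rightarrow> real) \<Rightarrow> ereal) \<Rightarrow> ('a set \<Rightarrow> real) \<Rightarrow> ('a \<Rightarrow> real) set"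
where
  "subdifferential \<Omega> F m\<^sub>0 =
     {\<phi>. continuous_on \<Omega> \<phi> \<and>
        (\<forall>m\<in>signed_measures \<Omega>. F m\<^sub>0 + ereal (signed_integral \<Omega> (m - m\<^sub>0) \<phi>) \<le> F m)}"

text \<open>The functional \<open>W\<^sub>2\<^sup>2(\<cdot>, \<mu>)/2\<close> on signed measures: the infimum ranges over at most one
  measure, and is \<open>\<infinity>\<close> if \<open>m\<close> is not a probability measure.\<close>

definition half_W2_sq ::
  "'a::euclidean_space set \<Rightarrow> 'a measure \<Rightarrow> ('a set \<Rightarrow> real) \<Rightarrow> ereal" where
  "half_W2_sq \<Omega> \<mu> m =
     (INF \<sigma>\<in>{\<sigma> \<in> prob_measures \<Omega>. measure \<sigma> = m}. ereal (1/2 * (wasserstein 2 \<sigma> \<mu>)\<^sup>2))"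

definition D_lip ::
  "'a::euclidean_space set \<Rightarrow> 'a measure \<Rightarrow> real \<Rightarrow> 'a measure \<Rightarrow> 'a measure \<Rightarrow> ereal" where
  "D_lip \<Omega> \<mu> l \<sigma> \<rho> =
     ereal (1/2 * (wasserstein 2 \<sigma> \<mu>)\<^sup>2) - ereal (1/2 * (wasserstein 2 \<rho> \<mu>)\<^sup>2)
     - (SUP \<phi>\<in>{\<phi> \<in> subdifferential \<Omega> (half_W2_sq \<Omega> \<mu>) (measure \<rho>). l-lipschitz_on \<Omega> \<phi>}.
          ereal (signed_integral \<Omega> (measure \<sigma> - measure \<rho>) \<phi>))"

end

theory Submission
  imports Defs "HOL-Complex_Analysis.Great_Picard"
begin

text \<open>Fix one step with parameter \<open>l = \<lambda>\<^sub>n\<close> and write \<open>\<nu>\<close>, \<open>\<rho>\<close> for \<open>\<nu>\<^sub>n\<close>, \<open>\<nu>\<^sub>n\<^sub>+\<^sub>1\<close>. Minimising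
  \<open>W\<^sub>2\<^sup>2(\<rho>, \<mu>) / 2 + l W\<^sub>1(\<rho>, \<nu>)\<close> amounts to transporting \<open>\<nu>\<close> to \<open>\<mu>\<close> through an intermediate measure, paying
  \<open>l dist x y\<close> on the first leg and \<open>(dist y z)\<^sup>2 / 2\<close> on the second. The best \<open>y\<close> lies on the segment from
  \<open>x\<close> to \<open>z\<close>, which stays in the convex set \<open>\<Omega>\<close>, and the resulting cost is the Huber function of
  \<open>dist x z\<close>, which is \<open>l\<close>-Lipschitz (\<open>split_cost_le_huber_cost\<close>).

  Kantorovich duality for this cost provides \<open>l\<close>-Lipschitz potentials \<open>\<phi>\<close>, \<open>\<psi>\<close>. Comparing values at the
  minimiser \<open>\<rho>\<close> shows that they are optimal simultaneously for \<open>W\<^sub>2\<^sup>2(\<rho>, \<mu>) / 2\<close> and, through \<open>\<phi>\<close> alone, for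
  \<open>l W\<^sub>1(\<nu>, \<rho>)\<close> (\<open>proximal_step_potentials\<close>). Hence \<open>\<phi>\<close> is a subgradient at \<open>\<rho>\<close> that attains the supremum in
  \<open>D_lip\<close>, with value \<open>l W\<^sub>1(\<nu>, \<rho>)\<close>. The \<open>n\<close>-th term of the series is therefore the decrease of
  \<open>W\<^sub>2\<^sup>2(\<cdot>, \<mu>) / 2\<close> in the \<open>n\<close>-th step, and the series telescopes. Moreover the potentials lie below the Huber
  cost, which grows only linearly, and this forces \<open>W\<^sub>2(\<rho>, \<mu>) \<le> l\<close>; with \<open>\<lambda>\<^sub>n = \<lambda>\<^sub>0 / 2\<^sup>n\<close> this is the rate, and it
  makes the telescoping remainder vanish (\<open>proximal_step\<close>).

  The analytic core is the duality theorem for Lipschitz costs on a compact set (\<open>kantorovich_duality\<close>).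
  It is obtained by entropic regularisation: for \<open>e > 0\<close> the regularised dual problem is solved by
  Arzela-Ascoli, the optimality condition says that the Gibbs density \<open>exp ((u x + v z - c x z) / e)\<close> with
  respect to the product measure is a coupling, and nonnegativity of entropy bounds the cost of this
  coupling by the dual value. All potentials share the Lipschitz constant of the cost, so one
  can let \<open>e\<close> tend to \<open>0\<close>.\<close>

section \<open>Probability measures on a set and their couplings\<close>

lemma prob_measuresD:
  assumes "\<sigma> \<in> prob_measures \<Omega>"
  shows "prob_space \<sigma>" "finite_measure \<sigma>" "sigma_finite_measure \<sigma>"
    "sets \<sigma> = sets (restrict_space borel \<Omega>)" "space \<sigma> = \<Omega>"
proof -
  show p: "prob_space \<sigma>" and s: "sets \<sigma> = sets (restrict_space borel \<Omega>)"
    using assms by (auto simp: prob_measures_def)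
  interpret prob_space \<sigma> by (fact p)
  show "finite_measure \<sigma>" "sigma_finite_measure \<sigma>" by unfold_locales
  show "space \<sigma> = \<Omega>"
    using sets_eq_imp_space_eq[OF s] by (simp add: space_restrict_space)
qed

text \<open>The sigma-algebra of a member of \<open>prob_measures \<Omega>\<close> is the trace of the Borel algebra, so a function
  that is continuous merely on \<open>\<Omega>\<close> is measurable; on a compact \<open>\<Omega>\<close> it is also integrable.\<close>
lemma prob_measures_borel_measurable:
  fixes f :: "'a::euclidean_space \<Rightarrow> 'b::topological_space"
  assumes "\<sigma> \<in> prob_measures \<Omega>" "continuous_on \<Omega> f"
  shows "f \<in> borel_measurable \<sigma>"
  using borel_measurable_continuous_on_restrict[OF assms(2)] prob_measuresD(4)[OF assms(1)]
  by (metis measurable_cong_sets)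

lemma prob_measures_integrable:
  fixes f :: "'a::euclidean_space \<Rightarrow> real"
  assumes "compact \<Omega>" "\<sigma> \<in> prob_measures \<Omega>" "continuous_on \<Omega> f"
  shows "integrable \<sigma> f"
proof -
  obtain B where B: "\<And>x. x \<in> \<Omega> \<Longrightarrow> norm (f x) \<le> B"
    using compact_imp_bounded[OF compact_continuous_image[OF assms(3,1)]]
    unfolding bounded_iff by auto
  show ?thesis
    using B prob_measures_borel_measurable[OF assms(2,3)] prob_measuresD[OF assms(2)]
    by (intro finite_measure.integrable_const_bound[of _ _ B]) auto
qed

lemma prob_measures_integral_mono:
  fixes f :: "'a::euclidean_space \<Rightarrow> real"
  assumes "compact \<Omega>" "\<sigma> \<in> prob_measures \<Omega>" "continuous_on \<Omega> f" "continuous_on \<Omega> g"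
    and "\<And>x. x \<in> \<Omega> \<Longrightarrow> f x \<le> g x"
  shows "integral\<^sup>L \<sigma> f \<le> integral\<^sup>L \<sigma> g"
  using assms prob_measuresD(5)[OF assms(2)]
  by (intro integral_mono prob_measures_integrable) auto

lemma prob_measures_measurableI:
  assumes "\<sigma> \<in> prob_measures \<Omega>" "f \<in> borel_measurable M" "\<And>x. x \<in> space M \<Longrightarrow> f x \<in> \<Omega>"
  shows "f \<in> measurable M \<sigma>"
proof -
  have "f \<in> measurable M (restrict_space borel \<Omega>)"
    using assms(2,3) by (intro measurable_restrict_space2) auto
  then show ?thesis
    using prob_measuresD(4)[OF assms(1)] by (metis measurable_cong_sets)
qed

lemma prob_measures_id_borel:
  assumes "\<sigma> \<in> prob_measures \<Omega>"
  shows "(\<lambda>x. x) \<in> borel_measurable \<sigma>"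
  using prob_measures_borel_measurable[OF assms continuous_on_id] by simp

lemma sets_subset_of_measurable_identity:
  assumes "(\<lambda>x. x) \<in> measurable M N" "space M = space N"
  shows "sets N \<subseteq> sets M"
proof
  fix A assume A: "A \<in> sets N"
  have "(\<lambda>x. x) -` A \<inter> space M = A"
    using sets.sets_into_space[OF A] assms(2) by auto
  then show "A \<in> sets M"
    using measurable_sets[OF assms(1) A] by simp
qed

text \<open>This makes a coupling of two measures on \<open>\<Omega>\<close> a member of \<open>prob_measures (\<Omega> \<times> \<Omega>)\<close>, so that the
  measurability and integrability lemmas above apply to couplings as well.\<close>
lemma sets_restrict_borel_pair:
  fixes A :: "'a::euclidean_space set" and B :: "'b::euclidean_space set"
  shows "sets (restrict_space borel A \<Otimes>\<^sub>M restrict_space borel B) = sets (restrict_space borel (A \<times> B))"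
    (is "sets (?A \<Otimes>\<^sub>M ?B) = sets ?AB")
proof
  have sp: "space (?A \<Otimes>\<^sub>M ?B) = space ?AB"
    by (auto simp: space_pair_measure space_restrict_space)
  have "(\<lambda>z. (fst z, snd z)) \<in> measurable (?A \<Otimes>\<^sub>M ?B) (borel \<Otimes>\<^sub>M borel)"
    by (intro measurable_Pair measurable_compose[OF measurable_fst]
        measurable_compose[OF measurable_snd] measurable_restrict_space1 measurable_ident_sets) auto
  then have "(\<lambda>z. z) \<in> measurable (?A \<Otimes>\<^sub>M ?B) ?AB"
    by (intro measurable_restrict_space2) (auto simp: borel_prod space_pair_measure space_restrict_space)
  then show "sets ?AB \<subseteq> sets (?A \<Otimes>\<^sub>M ?B)"
    using sp by (rule sets_subset_of_measurable_identity)
  have "(\<lambda>z. (fst z, snd z)) \<in> measurable ?AB (?A \<Otimes>\<^sub>M ?B)"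
    by (intro measurable_Pair measurable_restrict_space2 measurable_restrict_space1
        borel_measurable_continuous_onI)
      (auto simp: space_restrict_space intro!: continuous_intros)
  then have "(\<lambda>z. z) \<in> measurable ?AB (?A \<Otimes>\<^sub>M ?B)" by simp
  then show "sets (?A \<Otimes>\<^sub>M ?B) \<subseteq> sets ?AB"
    using sp[symmetric] by (rule sets_subset_of_measurable_identity)
qed

lemma sets_pair_prob_measures:
  assumes "\<sigma> \<in> prob_measures \<Omega>" "\<rho> \<in> prob_measures \<Omega>"
  shows "sets (\<sigma> \<Otimes>\<^sub>M \<rho>) = sets (restrict_space borel (\<Omega> \<times> \<Omega>))"
  using sets_pair_measure_cong[OF prob_measuresD(4)[OF assms(1)] prob_measuresD(4)[OF assms(2)]]
  by (simp add: sets_restrict_borel_pair)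

lemma pair_in_prob_measures:
  assumes "\<sigma> \<in> prob_measures \<Omega>" "\<rho> \<in> prob_measures \<Omega>"
  shows "\<sigma> \<Otimes>\<^sub>M \<rho> \<in> prob_measures (\<Omega> \<times> \<Omega>)"
  using sets_pair_prob_measures[OF assms] prob_measuresD(1)[OF assms(1)] prob_measuresD(1)[OF assms(2)]
  by (auto simp: prob_measures_def intro: prob_space_pair)

lemma couplings_in_prob_measures:
  assumes "\<sigma> \<in> prob_measures \<Omega>" "\<rho> \<in> prob_measures \<Omega>" "\<gamma> \<in> couplings \<sigma> \<rho>"
  shows "\<gamma> \<in> prob_measures (\<Omega> \<times> \<Omega>)"
proof -
  have s: "sets \<gamma> = sets (\<sigma> \<Otimes>\<^sub>M \<rho>)" and d: "distr \<gamma> \<sigma> fst = \<sigma>"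
    using assms(3) by (auto simp: couplings_def)
  have "fst \<in> measurable \<gamma> \<sigma>"
    using measurable_fst measurable_cong_sets[OF s refl] by blast
  then have "prob_space \<gamma>"
    using prob_space_distrD d prob_measuresD(1)[OF assms(1)] by metis
  then show ?thesis
    using s sets_pair_prob_measures[OF assms(1,2)] by (auto simp: prob_measures_def)
qed

lemma couplings_measurable:
  assumes "\<gamma> \<in> couplings \<sigma> \<rho>"
  shows "fst \<in> measurable \<gamma> \<sigma>" "snd \<in> measurable \<gamma> \<rho>"
proof -
  have s: "sets \<gamma> = sets (\<sigma> \<Otimes>\<^sub>M \<rho>)"
    using assms by (auto simp: couplings_def)
  show "fst \<in> measurable \<gamma> \<sigma>" "snd \<in> measurable \<gamma> \<rho>"
    using measurable_fst measurable_snd measurable_cong_sets[OF s refl] by blast+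
qed

lemma couplings_integral_marginals:
  fixes u v :: "'a::euclidean_space \<Rightarrow> real"
  assumes "compact \<Omega>" "\<sigma> \<in> prob_measures \<Omega>" "\<rho> \<in> prob_measures \<Omega>" "\<gamma> \<in> couplings \<sigma> \<rho>"
    and "continuous_on \<Omega> u" "continuous_on \<Omega> v"
  shows "(\<integral>z. u (fst z) + v (snd z) \<partial>\<gamma>) = integral\<^sup>L \<sigma> u + integral\<^sup>L \<rho> v"
proof -
  note g = couplings_in_prob_measures[OF assms(2-4)]
  note m = couplings_measurable[OF assms(4)]
  have d: "distr \<gamma> \<sigma> fst = \<sigma>" "distr \<gamma> \<rho> snd = \<rho>"
    using assms(4) by (auto simp: couplings_def)
  have u: "integral\<^sup>L \<sigma> u = (\<integral>z. u (fst z) \<partial>\<gamma>)"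
    using integral_distr[OF m(1) prob_measures_borel_measurable[OF assms(2,5)]] d by simp
  have v: "integral\<^sup>L \<rho> v = (\<integral>z. v (snd z) \<partial>\<gamma>)"
    using integral_distr[OF m(2) prob_measures_borel_measurable[OF assms(3,6)]] d by simp
  have "continuous_on (\<Omega> \<times> \<Omega>) (\<lambda>z. u (fst z))" "continuous_on (\<Omega> \<times> \<Omega>) (\<lambda>z. v (snd z))"
    by (auto intro!: continuous_on_compose2[OF assms(5)] continuous_on_compose2[OF assms(6)] continuous_intros)
  then have "integrable \<gamma> (\<lambda>z. u (fst z))" "integrable \<gamma> (\<lambda>z. v (snd z))"
    using prob_measures_integrable[OF _ g] assms(1) by (auto intro: compact_Times)
  then show ?thesis using u v by simp
qed

lemma pair_measure_in_couplings:
  assumes "\<sigma> \<in> prob_measures \<Omega>" "\<rho> \<in> prob_measures \<Omega>"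
  shows "\<sigma> \<Otimes>\<^sub>M \<rho> \<in> couplings \<sigma> \<rho>"
proof -
  interpret S: prob_space \<sigma> using prob_measuresD[OF assms(1)] by auto
  interpret R: prob_space \<rho> using prob_measuresD[OF assms(2)] by auto
  interpret P: pair_prob_space \<sigma> \<rho> ..
  have "distr (\<sigma> \<Otimes>\<^sub>M \<rho>) \<sigma> fst = \<sigma>" by (rule R.distr_pair_fst)
  moreover have "distr (\<sigma> \<Otimes>\<^sub>M \<rho>) \<rho> snd = \<rho>"
  proof (rule measure_eqI)
    fix A assume "A \<in> sets (distr (\<sigma> \<Otimes>\<^sub>M \<rho>) \<rho> snd)"
    then have A: "A \<in> sets \<rho>" by simp
    have "snd -` A \<inter> space (\<sigma> \<Otimes>\<^sub>M \<rho>) = space \<sigma> \<times> A"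
      using sets.sets_into_space[OF A] by (auto simp: space_pair_measure)
    then show "emeasure (distr (\<sigma> \<Otimes>\<^sub>M \<rho>) \<rho> snd) A = emeasure \<rho> A"
      using A by (simp add: emeasure_distr R.emeasure_pair_measure_Times S.emeasure_space_1)
  qed simp
  ultimately show ?thesis by (auto simp: couplings_def)
qed

lemma distr_in_couplings:
  assumes "f \<in> measurable M \<sigma>" "g \<in> measurable M \<rho>" "distr M \<sigma> f = \<sigma>" "distr M \<rho> g = \<rho>"
  shows "distr M (\<sigma> \<Otimes>\<^sub>M \<rho>) (\<lambda>w. (f w, g w)) \<in> couplings \<sigma> \<rho>"
  using assms by (auto simp: couplings_def distr_distr comp_def)

section \<open>Transport cost and Wasserstein distances\<close>

definition transport_cost :: "('a \<Rightarrow> 'a \<Rightarrow> real) \<Rightarrow> 'a measure \<Rightarrow> 'a measure \<Rightarrow> real" where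
  "transport_cost c \<sigma> \<rho> = (INF \<gamma>\<in>couplings \<sigma> \<rho>. \<integral>z. c (fst z) (snd z) \<partial>\<gamma>)"

lemma couplings_integral_nonneg:
  assumes "\<sigma> \<in> prob_measures \<Omega>" "\<rho> \<in> prob_measures \<Omega>" "\<gamma> \<in> couplings \<sigma> \<rho>"
    and "\<And>x y. x \<in> \<Omega> \<Longrightarrow> y \<in> \<Omega> \<Longrightarrow> 0 \<le> c x y"
  shows "0 \<le> (\<integral>z. c (fst z) (snd z) \<partial>\<gamma> :: real)"
  using assms(4) prob_measuresD(5)[OF couplings_in_prob_measures[OF assms(1-3)]]
  by (intro Bochner_Integration.integral_nonneg) auto

lemma transport_cost_le:
  assumes "\<sigma> \<in> prob_measures \<Omega>" "\<rho> \<in> prob_measures \<Omega>" "\<gamma> \<in> couplings \<sigma> \<rho>"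
    and "\<And>x y. x \<in> \<Omega> \<Longrightarrow> y \<in> \<Omega> \<Longrightarrow> 0 \<le> c x y"
  shows "transport_cost c \<sigma> \<rho> \<le> (\<integral>z. c (fst z) (snd z) \<partial>\<gamma>)"
  unfolding transport_cost_def
proof (rule cINF_lower[OF _ assms(3)])
  show "bdd_below ((\<lambda>\<gamma>. \<integral>z. c (fst z) (snd z) \<partial>\<gamma>) ` couplings \<sigma> \<rho>)"
    using couplings_integral_nonneg[where c=c, OF assms(1,2) _ assms(4)] by (intro bdd_belowI2[of _ 0])
qed

lemma transport_cost_ge:
  assumes "\<sigma> \<in> prob_measures \<Omega>" "\<rho> \<in> prob_measures \<Omega>"
    and "\<And>\<gamma>. \<gamma> \<in> couplings \<sigma> \<rho> \<Longrightarrow> K \<le> (\<integral>z. c (fst z) (snd z) \<partial>\<gamma>)"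
  shows "K \<le> transport_cost c \<sigma> \<rho>"
  unfolding transport_cost_def
  using pair_measure_in_couplings[OF assms(1,2)] assms(3) by (intro cINF_greatest) auto

lemma transport_cost_nonneg:
  assumes "\<sigma> \<in> prob_measures \<Omega>" "\<rho> \<in> prob_measures \<Omega>"
    and "\<And>x y. x \<in> \<Omega> \<Longrightarrow> y \<in> \<Omega> \<Longrightarrow> 0 \<le> c x y"
  shows "0 \<le> transport_cost c \<sigma> \<rho>"
  by (rule transport_cost_ge[OF assms(1,2)]) (rule couplings_integral_nonneg[OF assms(1,2) _ assms(3)])

text \<open>The joint law of two random variables with the prescribed laws is a coupling.\<close>
lemma transport_cost_random_variables_le:
  assumes "\<sigma> \<in> prob_measures \<Omega>" "\<rho> \<in> prob_measures \<Omega>"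
    and "\<And>x y. x \<in> \<Omega> \<Longrightarrow> y \<in> \<Omega> \<Longrightarrow> 0 \<le> c x y"
    and cont: "continuous_on (\<Omega> \<times> \<Omega>) (\<lambda>z. c (fst z) (snd z))"
    and fg: "f \<in> measurable M \<sigma>" "g \<in> measurable M \<rho>" "distr M \<sigma> f = \<sigma>" "distr M \<rho> g = \<rho>"
  shows "transport_cost c \<sigma> \<rho> \<le> (\<integral>w. c (f w) (g w) \<partial>M)"
proof -
  have "transport_cost c \<sigma> \<rho> \<le> (\<integral>z. c (fst z) (snd z) \<partial>(distr M (\<sigma> \<Otimes>\<^sub>M \<rho>) (\<lambda>w. (f w, g w))))"
    using distr_in_couplings[OF fg] assms by (intro transport_cost_le)
  also have "\<dots> = (\<integral>w. c (f w) (g w) \<partial>M)"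
    using fg prob_measures_borel_measurable[OF pair_in_prob_measures[OF assms(1,2)] cont]
    by (subst integral_distr) auto
  finally show ?thesis .
qed

text \<open>The easy half of Kantorovich duality: integrate \<open>u x + v y \<le> c x y\<close> against a coupling.\<close>
lemma transport_cost_dual_le:
  assumes "compact \<Omega>" "\<sigma> \<in> prob_measures \<Omega>" "\<rho> \<in> prob_measures \<Omega>"
    and cont: "continuous_on (\<Omega> \<times> \<Omega>) (\<lambda>z. c (fst z) (snd z))"
    and uv: "continuous_on \<Omega> u" "continuous_on \<Omega> v"
    and le: "\<And>x y. x \<in> \<Omega> \<Longrightarrow> y \<in> \<Omega> \<Longrightarrow> u x + v y \<le> c x y"
  shows "integral\<^sup>L \<sigma> u + integral\<^sup>L \<rho> v \<le> transport_cost c \<sigma> \<rho>"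
proof (rule transport_cost_ge[OF assms(2,3)])
  fix \<gamma> assume g: "\<gamma> \<in> couplings \<sigma> \<rho>"
  have "(\<integral>z. u (fst z) + v (snd z) \<partial>\<gamma>) \<le> (\<integral>z. c (fst z) (snd z) \<partial>\<gamma>)"
    by (rule prob_measures_integral_mono[OF compact_Times[OF assms(1,1)] couplings_in_prob_measures[OF assms(2,3) g]])
       (auto intro!: cont le continuous_on_compose2[OF uv(1)] continuous_on_compose2[OF uv(2)] continuous_intros)
  then show "integral\<^sup>L \<sigma> u + integral\<^sup>L \<rho> v \<le> (\<integral>z. c (fst z) (snd z) \<partial>\<gamma>)"
    using couplings_integral_marginals[OF assms(1-3) g uv] by simp
qed

lemma transport_cost_commute_le:
  assumes "\<sigma> \<in> prob_measures \<Omega>" "\<rho> \<in> prob_measures \<Omega>"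
    and nn: "\<And>x y. x \<in> \<Omega> \<Longrightarrow> y \<in> \<Omega> \<Longrightarrow> 0 \<le> c x y"
    and cont: "continuous_on (\<Omega> \<times> \<Omega>) (\<lambda>z. c (fst z) (snd z))"
    and sym: "\<And>x y. c x y = c y x"
  shows "transport_cost c \<sigma> \<rho> \<le> transport_cost c \<rho> \<sigma>"
proof (rule transport_cost_ge[OF assms(2,1)])
  fix \<gamma> assume g: "\<gamma> \<in> couplings \<rho> \<sigma>"
  have "transport_cost c \<sigma> \<rho> \<le> (\<integral>z. c (snd z) (fst z) \<partial>\<gamma>)"
    using couplings_measurable[OF g] g
    by (intro transport_cost_random_variables_le[OF assms(1-4)]) (auto simp: couplings_def)
  then show "transport_cost c \<sigma> \<rho> \<le> (\<integral>z. c (fst z) (snd z) \<partial>\<gamma>)"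
    using sym by simp
qed

lemma transport_cost_commute:
  assumes "\<sigma> \<in> prob_measures \<Omega>" "\<rho> \<in> prob_measures \<Omega>"
    and "\<And>x y. x \<in> \<Omega> \<Longrightarrow> y \<in> \<Omega> \<Longrightarrow> 0 \<le> c x y"
    and "continuous_on (\<Omega> \<times> \<Omega>) (\<lambda>z. c (fst z) (snd z))"
    and "\<And>x y. c x y = c y x"
  shows "transport_cost c \<sigma> \<rho> = transport_cost c \<rho> \<sigma>"
  using transport_cost_commute_le[of \<sigma> \<Omega> \<rho> c] transport_cost_commute_le[of \<rho> \<Omega> \<sigma> c] assms
  by (intro antisym) auto

lemma wasserstein_1_eq:
  assumes "\<sigma> \<in> prob_measures \<Omega>" "\<rho> \<in> prob_measures \<Omega>"
  shows "wasserstein 1 \<sigma> \<rho> = transport_cost dist \<sigma> \<rho>"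
  using transport_cost_nonneg[OF assms, of dist]
  by (simp add: wasserstein_def transport_cost_def)

lemma wasserstein_2_sq_eq:
  assumes "\<sigma> \<in> prob_measures \<Omega>" "\<rho> \<in> prob_measures \<Omega>"
  shows "(wasserstein 2 \<sigma> \<rho>)\<^sup>2 = transport_cost (\<lambda>x y. (dist x y)\<^sup>2) \<sigma> \<rho>"
  using transport_cost_nonneg[OF assms, of "\<lambda>x y. (dist x y)\<^sup>2"]
  by (simp add: wasserstein_def transport_cost_def powr_half_sqrt)

lemma wasserstein_commute:
  assumes "\<sigma> \<in> prob_measures \<Omega>" "\<rho> \<in> prob_measures \<Omega>" "p > 0"
  shows "wasserstein p \<sigma> \<rho> = wasserstein p \<rho> \<sigma>"
proof -
  have "continuous_on (\<Omega> \<times> \<Omega>) (\<lambda>z. dist (fst z) (snd z) powr p)"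
    using assms(3) by (intro continuous_on_powr') (auto intro!: continuous_intros)
  then have "transport_cost (\<lambda>x y. dist x y powr p) \<sigma> \<rho> = transport_cost (\<lambda>x y. dist x y powr p) \<rho> \<sigma>"
    by (intro transport_cost_commute[OF assms(1,2)]) (auto simp: dist_commute)
  then show ?thesis by (simp add: wasserstein_def transport_cost_def)
qed

lemma prob_measures_nonempty: "\<sigma> \<in> prob_measures \<Omega> \<Longrightarrow> \<Omega> \<noteq> {}"
  using prob_measuresD(1,5) prob_space.not_empty by metis

lemma prob_measures_measure_space:
  "\<sigma> \<in> prob_measures \<Omega> \<Longrightarrow> measure \<sigma> (space \<sigma>) = 1"
  using prob_space.prob_space[OF prob_measuresD(1)] by auto

lemma prob_measures_integral_le_const_add:
  fixes f g :: "'a::euclidean_space \<Rightarrow> real"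
  assumes "compact \<Omega>" "\<sigma> \<in> prob_measures \<Omega>" "continuous_on \<Omega> f" "continuous_on \<Omega> g"
    and "\<And>x. x \<in> \<Omega> \<Longrightarrow> f x \<le> g x + K"
  shows "integral\<^sup>L \<sigma> f \<le> integral\<^sup>L \<sigma> g + K"
proof -
  have "integral\<^sup>L \<sigma> f \<le> (\<integral>x. g x + K \<partial>\<sigma>)"
    using assms by (intro prob_measures_integral_mono[OF assms(1,2,3)]) (auto intro!: continuous_intros)
  also have "\<dots> = integral\<^sup>L \<sigma> g + (\<integral>x. K \<partial>\<sigma>)"
    using prob_measures_integrable[OF assms(1,2)] assms(4) by (intro Bochner_Integration.integral_add) auto
  finally show ?thesis using prob_measures_measure_space[OF assms(2)] by simp
qed

text \<open>Arzela-Ascoli for a fixed Lipschitz constant, which the uniform limit inherits.\<close>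
lemma lipschitz_bounded_subsequence:
  fixes f :: "nat \<Rightarrow> 'a::euclidean_space \<Rightarrow> real"
  assumes "compact S" "\<And>n. L-lipschitz_on S (f n)" "\<And>n x. x \<in> S \<Longrightarrow> \<bar>f n x\<bar> \<le> B"
  obtains g k where "strict_mono (k::nat \<Rightarrow> nat)" "L-lipschitz_on S g"
    "uniform_limit S (\<lambda>n. f (k n)) g sequentially"
proof -
  have L: "L \<ge> 0" using assms(2) lipschitz_on_nonneg by blast
  obtain g k where k: "strict_mono (k::nat \<Rightarrow> nat)"
    and lim: "\<And>e. 0 < e \<Longrightarrow> \<exists>N. \<forall>n x. n \<ge> N \<and> x \<in> S \<longrightarrow> norm (f (k n) x - g x) < e"
  proof (rule Arzela_Ascoli[OF assms(1), of f B])
    show "norm (f n x) \<le> B" if "x \<in> S" for n x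
      using assms(3)[OF that] by simp
    fix x and e :: real assume x: "x \<in> S" and e: "0 < e"
    have "\<bar>f n x - f n y\<bar> < e" if "y \<in> S" "norm (x - y) < e / (L + 1)" for n y
    proof -
      have "\<bar>f n x - f n y\<bar> \<le> L * dist x y"
        using lipschitz_onD[OF assms(2) x that(1)] by (simp add: dist_real_def)
      also have "\<dots> \<le> (L + 1) * dist x y" by (simp add: distrib_right)
      also have "\<dots> < e" using that(2) L by (simp add: dist_norm field_simps)
      finally show ?thesis .
    qed
    then show "\<exists>d>0. \<forall>n y. y \<in> S \<and> norm (x - y) < d \<longrightarrow> norm (f n x - f n y) < e"
      using e L by (intro exI[of _ "e / (L + 1)"]) auto
  qed blast
  have ul: "uniform_limit S (\<lambda>n. f (k n)) g sequentially"
    unfolding uniform_limit_iff eventually_sequentially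
    using lim by (simp add: dist_real_def) meson
  have "L-lipschitz_on S g"
  proof (rule lipschitz_onI[OF _ L])
    fix x y assume xy: "x \<in> S" "y \<in> S"
    have "(\<lambda>n. dist (f (k n) x) (f (k n) y)) \<longlonglongrightarrow> dist (g x) (g y)"
      by (intro tendsto_dist tendsto_uniform_limitI[OF ul] xy)
    then show "dist (g x) (g y) \<le> L * dist x y"
      using lipschitz_onD[OF assms(2) xy] by (intro LIMSEQ_le_const2) auto
  qed
  with k ul that show ?thesis by blast
qed

section \<open>Soft conjugation\<close>

text \<open>A smooth substitute for the \<open>M\<close>-essential infimum of \<open>f\<close>, to which it converges as \<open>e\<close> tends to \<open>0\<close>.\<close>
definition softmin :: "real \<Rightarrow> 'a measure \<Rightarrow> ('a \<Rightarrow> real) \<Rightarrow> real" where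
  "softmin e M f = - e * ln (\<integral>x. exp (- f x / e) \<partial>M)"

lemma exp_softmin:
  fixes f :: "'a::euclidean_space \<Rightarrow> real"
  assumes "compact \<Omega>" "M \<in> prob_measures \<Omega>" "continuous_on \<Omega> f" "e > 0"
  shows "exp (- softmin e M f / e) = (\<integral>x. exp (- f x / e) \<partial>M)"
proof -
  obtain B where B: "\<And>x. x \<in> \<Omega> \<Longrightarrow> norm (f x) \<le> B"
    using compact_imp_bounded[OF compact_continuous_image[OF assms(3,1)]]
    unfolding bounded_iff by auto
  have "0 < exp (- B / e)" by simp
  also have "\<dots> = (\<integral>x. exp (- B / e) \<partial>M)"
    using prob_measures_measure_space[OF assms(2)] by simp
  also have "\<dots> \<le> (\<integral>x. exp (- f x / e) \<partial>M)"
  proof (rule prob_measures_integral_mono[OF assms(1,2)])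
    show "exp (- B / e) \<le> exp (- f x / e)" if "x \<in> \<Omega>" for x
      using B[OF that] assms(4) by (simp add: divide_right_mono)
  qed (use assms(3,4) in \<open>auto intro!: continuous_intros\<close>)
  finally show ?thesis using assms(4) by (simp add: softmin_def)
qed

lemma softmin_le_add:
  fixes f g :: "'a::euclidean_space \<Rightarrow> real"
  assumes "compact \<Omega>" "M \<in> prob_measures \<Omega>" "continuous_on \<Omega> f" "continuous_on \<Omega> g" "e > 0"
    and le: "\<And>x. x \<in> \<Omega> \<Longrightarrow> f x \<le> g x + K"
  shows "softmin e M f \<le> softmin e M g + K"
proof -
  have "exp (- (softmin e M g + K) / e) = exp (- K / e) * (\<integral>x. exp (- g x / e) \<partial>M)"
    using exp_softmin[OF assms(1,2,4,5)] by (simp add: exp_diff exp_minus diff_divide_distrib field_simps)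
  also have "\<dots> = (\<integral>x. exp (- K / e) * exp (- g x / e) \<partial>M)"
    by simp
  also have "\<dots> \<le> (\<integral>x. exp (- f x / e) \<partial>M)"
  proof (rule prob_measures_integral_mono[OF assms(1,2)])
    fix x assume "x \<in> \<Omega>"
    then have "(- K - g x) / e \<le> - f x / e"
      using le[of x] assms(5) by (intro divide_right_mono) auto
    then show "exp (- K / e) * exp (- g x / e) \<le> exp (- f x / e)"
      by (simp add: exp_add[symmetric] diff_divide_distrib)
  qed (use assms(3-5) in \<open>auto intro!: continuous_intros\<close>)
  also have "\<dots> = exp (- softmin e M f / e)"
    using exp_softmin[OF assms(1-3,5)] by simp
  finally have "e * softmin e M f \<le> e * (softmin e M g + K)"
    using assms(5) by (simp add: field_simps)
  then show ?thesis using assms(5) by simp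
qed

lemma softmin_const:
  assumes "M \<in> prob_measures \<Omega>" "e > 0"
  shows "softmin e M (\<lambda>x. a) = a"
  using prob_measures_measure_space[OF assms(1)] assms(2) by (simp add: softmin_def)

lemma softmin_bound:
  fixes f :: "'a::euclidean_space \<Rightarrow> real"
  assumes "compact \<Omega>" "M \<in> prob_measures \<Omega>" "continuous_on \<Omega> f" "e > 0"
    and "\<And>x. x \<in> \<Omega> \<Longrightarrow> \<bar>f x\<bar> \<le> K"
  shows "\<bar>softmin e M f\<bar> \<le> K"
  using softmin_le_add[OF assms(1-3) continuous_on_const assms(4), of 0 K]
    softmin_le_add[OF assms(1,2) continuous_on_const assms(3,4), of 0 K] assms(5)
  by (fastforce simp: softmin_const[OF assms(2,4)] abs_le_iff)

text \<open>The entropic version of the \<open>c\<close>-transform \<open>x \<mapsto> inf\<^sub>z (c x z - v z)\<close>.\<close>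
definition soft_conjugate ::
  "real \<Rightarrow> 'a measure \<Rightarrow> ('a \<Rightarrow> 'a \<Rightarrow> real) \<Rightarrow> ('a \<Rightarrow> real) \<Rightarrow> 'a \<Rightarrow> real" where
  "soft_conjugate e N c v x = softmin e N (\<lambda>z. c x z - v z)"

locale lipschitz_transport =
  fixes \<Omega> :: "'a::euclidean_space set" and L :: real and c :: "'a \<Rightarrow> 'a \<Rightarrow> real"
    and M N :: "'a measure"
  assumes compact: "compact \<Omega>"
    and M: "M \<in> prob_measures \<Omega>" and N: "N \<in> prob_measures \<Omega>"
    and lipschitz_fst: "z \<in> \<Omega> \<Longrightarrow> L-lipschitz_on \<Omega> (\<lambda>x. c x z)"
    and lipschitz_snd: "x \<in> \<Omega> \<Longrightarrow> L-lipschitz_on \<Omega> (c x)"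
begin

text \<open>The hypotheses are symmetric in the two measures. Results for the conjugation that integrates
  over \<open>N\<close> thus transfer to the one that integrates over \<open>M\<close>.\<close>
lemma swap: "lipschitz_transport \<Omega> L (\<lambda>z x. c x z) N M"
  by unfold_locales (use compact M N lipschitz_fst lipschitz_snd in auto)

lemma L_nonneg: "L \<ge> 0"
  using prob_measures_nonempty[OF M] lipschitz_fst lipschitz_on_nonneg by blast

lemma cost_continuous: "continuous_on (\<Omega> \<times> \<Omega>) (\<lambda>z. c (fst z) (snd z))"
proof (rule lipschitz_on_continuous_on, rule lipschitz_onI)
  show "0 \<le> 2 * L" using L_nonneg by simp
  fix p q assume pq: "p \<in> \<Omega> \<times> \<Omega>" "q \<in> \<Omega> \<times> \<Omega>"
  have "dist (c (fst p) (snd p)) (c (fst q) (snd q))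
      \<le> dist (c (fst p) (snd p)) (c (fst q) (snd p)) + dist (c (fst q) (snd p)) (c (fst q) (snd q))"
    by (rule dist_triangle)
  also have "\<dots> \<le> L * dist (fst p) (fst q) + L * dist (snd p) (snd q)"
    using pq by (intro add_mono lipschitz_onD[OF lipschitz_fst] lipschitz_onD[OF lipschitz_snd]) auto
  also have "\<dots> \<le> L * dist p q + L * dist p q"
    using L_nonneg by (intro add_mono mult_left_mono dist_fst_le dist_snd_le)
  finally show "dist (c (fst p) (snd p)) (c (fst q) (snd q)) \<le> 2 * L * dist p q" by simp
qed

lemma cost_continuous_fst: "z \<in> \<Omega> \<Longrightarrow> continuous_on \<Omega> (\<lambda>x. c x z)"
  and cost_continuous_snd: "x \<in> \<Omega> \<Longrightarrow> continuous_on \<Omega> (c x)"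
  using lipschitz_fst lipschitz_snd lipschitz_on_continuous_on by blast+

text \<open>For \<open>a = soft_conjugate e N c v x\<close> the left-hand side is \<open>1\<close>: soft conjugation is exactly the
  normalisation that gives the Gibbs density \<open>exp ((u x + v z - c x z) / e)\<close> mass one in \<open>z\<close>, for every
  \<open>x \<in> \<Omega>\<close> and not merely almost every one.\<close>
lemma exp_soft_conjugate:
  assumes "e > 0" "continuous_on \<Omega> v" "x \<in> \<Omega>"
  shows "exp ((a - soft_conjugate e N c v x) / e) = (\<integral>z. exp ((a + v z - c x z) / e) \<partial>N)"
proof -
  have "exp ((a - soft_conjugate e N c v x) / e) = exp (a / e) * exp (- soft_conjugate e N c v x / e)"
    by (simp add: exp_add[symmetric] diff_divide_distrib)
  also have "\<dots> = (\<integral>z. exp (a / e) * exp (- (c x z - v z) / e) \<partial>N)"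
    using exp_softmin[OF compact N _ assms(1), of "\<lambda>z. c x z - v z"] assms(2) cost_continuous_snd[OF assms(3)]
    by (simp add: soft_conjugate_def continuous_intros)
  also have "\<dots> = (\<integral>z. exp ((a + v z - c x z) / e) \<partial>N)"
    by (simp add: exp_add[symmetric] add_divide_distrib[symmetric] algebra_simps)
  finally show ?thesis .
qed

lemma soft_conjugate_le_add:
  assumes "e > 0" "continuous_on \<Omega> v" "continuous_on \<Omega> v'" "x \<in> \<Omega>"
    and "\<And>z. z \<in> \<Omega> \<Longrightarrow> v' z \<le> v z + K"
  shows "soft_conjugate e N c v x \<le> soft_conjugate e N c v' x + K"
  unfolding soft_conjugate_def
  using assms cost_continuous_snd[OF assms(4)]
  by (intro softmin_le_add[OF compact N]) (fastforce intro!: continuous_intros)+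

text \<open>The Lipschitz constant comes from the cost alone and does not deteriorate as \<open>e\<close> tends to \<open>0\<close>. This
  uniform bound is what provides compactness, both for fixed \<open>e\<close> and in the limit.\<close>
lemma soft_conjugate_lipschitz:
  assumes "e > 0" "continuous_on \<Omega> v"
  shows "L-lipschitz_on \<Omega> (soft_conjugate e N c v)"
proof (rule lipschitz_onI[OF _ L_nonneg])
  have one: "soft_conjugate e N c v x \<le> soft_conjugate e N c v y + L * dist x y"
    if "x \<in> \<Omega>" "y \<in> \<Omega>" for x y
    unfolding soft_conjugate_def
  proof (rule softmin_le_add[OF compact N _ _ assms(1)])
    fix z assume "z \<in> \<Omega>"
    then show "c x z - v z \<le> c y z - v z + L * dist x y"
      using lipschitz_onD[OF lipschitz_fst that] by (force simp: dist_real_def)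
  qed (use that assms(2) cost_continuous_snd in \<open>auto intro!: continuous_intros\<close>)
  fix x y assume "x \<in> \<Omega>" "y \<in> \<Omega>"
  then show "dist (soft_conjugate e N c v x) (soft_conjugate e N c v y) \<le> L * dist x y"
    using one[of x y] one[of y x] by (auto simp: dist_real_def abs_le_iff dist_commute)
qed

lemma soft_conjugate_continuous:
  assumes "e > 0" "continuous_on \<Omega> v"
  shows "continuous_on \<Omega> (soft_conjugate e N c v)"
  using lipschitz_on_continuous_on[OF soft_conjugate_lipschitz[OF assms]] .

lemma gibbs_continuous:
  assumes "continuous_on \<Omega> u" "continuous_on \<Omega> v"
  shows "continuous_on (\<Omega> \<times> \<Omega>) (\<lambda>p. (u (fst p) + v (snd p) - c (fst p) (snd p)) / e)"
  unfolding divide_inverse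
  by (intro continuous_intros cost_continuous)
    (auto intro!: continuous_on_compose2[OF assms(1)] continuous_on_compose2[OF assms(2)] continuous_intros)

text \<open>Conjugating twice does not decrease the integral, and preserves it only at a fixed point. With
  \<open>t = (u - u') / e\<close>, Fubini and the normalisation of the inner conjugate give \<open>\<integral> exp t = 1\<close>, and the claim
  is \<open>exp t \<ge> 1 + t\<close> together with its equality case \<open>t = 0\<close>.\<close>
lemma integral_soft_biconjugate:
  fixes e u
  assumes e: "e > 0" and u: "continuous_on \<Omega> u"
  defines "u' \<equiv> soft_conjugate e N c (soft_conjugate e M (\<lambda>z x. c x z) u)"
  shows "integral\<^sup>L M u \<le> integral\<^sup>L M u'"
    and "integral\<^sup>L M u = integral\<^sup>L M u' \<Longrightarrow> AE x in M. u x = u' x"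
proof -
  interpret S: lipschitz_transport \<Omega> L "\<lambda>z x. c x z" N M by (rule swap)
  define w where "w = soft_conjugate e M (\<lambda>z x. c x z) u"
  have w: "continuous_on \<Omega> w"
    unfolding w_def by (rule S.soft_conjugate_continuous[OF e u])
  have u': "continuous_on \<Omega> u'"
    unfolding u'_def w_def[symmetric] by (rule soft_conjugate_continuous[OF e w])
  interpret P: pair_sigma_finite M N
    using prob_measuresD(3)[OF M] prob_measuresD(3)[OF N] by (simp add: pair_sigma_finite_def)
  have int: "integrable (M \<Otimes>\<^sub>M N) (\<lambda>(x, z). exp ((u x + w z - c x z) / e))"
    using prob_measures_integrable[OF compact_Times[OF compact compact] pair_in_prob_measures[OF M N]
        continuous_on_exp[OF gibbs_continuous[OF u w]], of e]
    by (simp add: case_prod_unfold)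
  have "(\<integral>x. exp ((u x - u' x) / e) \<partial>M) = (\<integral>x. (\<integral>z. exp ((u x + w z - c x z) / e) \<partial>N) \<partial>M)"
    using exp_soft_conjugate[OF e w] prob_measuresD(5)[OF M]
    by (intro Bochner_Integration.integral_cong) (auto simp: u'_def w_def)
  also have "\<dots> = (\<integral>z. (\<integral>x. exp ((u x + w z - c x z) / e) \<partial>M) \<partial>N)"
    using P.Fubini_integral[OF int] by simp
  also have "\<dots> = (\<integral>z. 1 \<partial>N)"
  proof (rule Bochner_Integration.integral_cong[OF refl])
    fix z assume "z \<in> space N"
    then show "(\<integral>x. exp ((u x + w z - c x z) / e) \<partial>M) = 1"
      using S.exp_soft_conjugate[OF e u, of z "w z"] prob_measuresD(5)[OF N]
      by (simp add: w_def add.commute)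
  qed
  finally have one: "(\<integral>x. exp ((u x - u' x) / e) \<partial>M) = 1"
    using prob_measures_measure_space[OF N] by simp
  define t where "t x = (u x - u' x) / e" for x
  have t: "continuous_on \<Omega> t"
    unfolding t_def using e by (intro continuous_intros u u') auto
  note i = prob_measures_integrable[OF compact M]
  have tint: "integrable M t" "integrable M (\<lambda>x. exp (t x))" "integrable M (\<lambda>x. exp (t x) - 1 - t x)"
    by (intro i continuous_intros t)+
  have eq: "(\<integral>x. exp (t x) - 1 - t x \<partial>M) = (integral\<^sup>L M u' - integral\<^sup>L M u) / e"
  proof -
    have "(\<integral>x. exp (t x) - 1 - t x \<partial>M) = (\<integral>x. exp (t x) \<partial>M) - (\<integral>x. 1 \<partial>M) - integral\<^sup>L M t"
      using tint i[OF continuous_on_const[of _ 1]] by simp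
    also have "\<dots> = - integral\<^sup>L M t"
      using one prob_measures_measure_space[OF M] by (simp add: t_def)
    also have "integral\<^sup>L M t = (integral\<^sup>L M u - integral\<^sup>L M u') / e"
      using i[OF u] i[OF u'] by (simp add: t_def[abs_def])
    finally show ?thesis by (simp add: diff_divide_distrib)
  qed
  have nn: "0 \<le> exp (t x) - 1 - t x" for x
    using exp_ge_add_one_self[of "t x"] by linarith
  have "0 \<le> (\<integral>x. exp (t x) - 1 - t x \<partial>M)"
    using nn by simp
  then show "integral\<^sup>L M u \<le> integral\<^sup>L M u'"
    using e eq by (simp add: zero_le_divide_iff)
  assume "integral\<^sup>L M u = integral\<^sup>L M u'"
  then have "AE x in M. exp (t x) - 1 - t x = 0"
    using eq nn by (subst integral_nonneg_eq_0_iff_AE[OF tint(3), symmetric]) auto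
  then show "AE x in M. u x = u' x"
  proof eventually_elim
    case (elim x)
    then have "exp (- (- t x)) = 1 - (- t x)" by simp
    then have "t x = 0" using exp_minus_greater[of "- t x"] by force
    then show ?case using e by (simp add: t_def)
  qed
qed

end

section \<open>The Schroedinger system\<close>

context lipschitz_transport
begin

text \<open>Solves the Schroedinger system. The entropic dual functional \<open>D\<close> attains its maximum over the
  \<open>L\<close>-Lipschitz functions that vanish at \<open>x0\<close>, a compact set. Passing from \<open>v\<close> to its soft biconjugate
  does not decrease \<open>D\<close>, so at a maximiser equality holds in \<open>integral_soft_biconjugate\<close>, which makes \<open>v\<close>
  a fixed point.\<close>
lemma ex_schroedinger_potential:
  fixes e :: real
  assumes e: "e > 0" and x0: "x0 \<in> \<Omega>"
  obtains v where "L-lipschitz_on \<Omega> v" "v x0 = 0"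
    "AE z in N. v z = soft_conjugate e M (\<lambda>z x. c x z) (soft_conjugate e N c v) z"
proof -
  interpret S: lipschitz_transport \<Omega> L "\<lambda>z x. c x z" N M by (rule swap)
  let ?T = "soft_conjugate e N c" and ?S = "soft_conjugate e M (\<lambda>z x. c x z)"
  define D where "D v = integral\<^sup>L M (?T v) + integral\<^sup>L N v" for v
  define K where "K = {v :: 'a \<Rightarrow> real. L-lipschitz_on \<Omega> v \<and> v x0 = 0}"
  have Kc: "continuous_on \<Omega> v" if "v \<in> K" for v
    using that lipschitz_on_continuous_on by (auto simp: K_def)
  have D_le: "D v \<le> D v' + 2 * d"
    if v: "continuous_on \<Omega> v" "continuous_on \<Omega> v'" and d: "\<And>z. z \<in> \<Omega> \<Longrightarrow> \<bar>v z - v' z\<bar> \<le> d" for v v' d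
  proof -
    have le: "v z \<le> v' z + d" "v' z \<le> v z + d" if "z \<in> \<Omega>" for z
      using d[OF that] by linarith+
    have "integral\<^sup>L M (?T v) \<le> integral\<^sup>L M (?T v') + d"
      by (rule prob_measures_integral_le_const_add[OF compact M soft_conjugate_continuous[OF e v(1)]
            soft_conjugate_continuous[OF e v(2)]], rule soft_conjugate_le_add[OF e v]) (auto intro: le(2))
    moreover have "integral\<^sup>L N v \<le> integral\<^sup>L N v' + d"
      by (rule prob_measures_integral_le_const_add[OF compact N v le(1)])
    ultimately show ?thesis by (simp add: D_def)
  qed
  obtain R where R: "\<And>z. z \<in> \<Omega> \<Longrightarrow> dist x0 z \<le> R"
    using compact_imp_bounded[OF compact] bounded_any_center[of \<Omega> x0] by auto
  have Kb: "\<bar>v z\<bar> \<le> L * R" if "v \<in> K" "z \<in> \<Omega>" for v z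
  proof -
    have "\<bar>v z\<bar> = dist (v x0) (v z)" using that by (simp add: K_def dist_real_def)
    also have "\<dots> \<le> L * dist x0 z"
      using that x0 by (intro lipschitz_onD) (auto simp: K_def)
    also have "\<dots> \<le> L * R" using R[OF that(2)] L_nonneg by (rule mult_left_mono)
    finally show ?thesis .
  qed
  have z: "(\<lambda>_. 0) \<in> K" using L_nonneg by (auto simp: K_def intro!: lipschitz_onI)
  have bdd: "bdd_above (D ` K)"
  proof (rule bdd_aboveI2)
    fix v assume "v \<in> K"
    then show "D v \<le> D (\<lambda>_. 0) + 2 * (L * R)"
      using Kb[of v] by (intro D_le Kc z) auto
  qed
  define s where "s = (SUP v\<in>K. D v)"
  have "\<exists>v. v \<in> K \<and> s - inverse (real (Suc n)) < D v" for n
  proof -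
    have "K \<noteq> {}" using z by blast
    have "s - inverse (real (Suc n)) < s" by simp
    then have "\<exists>v\<in>K. s - inverse (real (Suc n)) < D v"
      unfolding s_def by (simp only: less_cSUP_iff[OF \<open>K \<noteq> {}\<close> bdd])
    then show ?thesis by (simp only: Bex_def)
  qed
  then obtain f where "\<forall>n. f n \<in> K \<and> s - inverse (real (Suc n)) < D (f n)"
    using choice[of "\<lambda>n v. v \<in> K \<and> s - inverse (real (Suc n)) < D v"] by presburger
  then have fK: "f n \<in> K" and f: "s - inverse (real (Suc n)) < D (f n)" for n
    by simp_all
  have fL: "L-lipschitz_on \<Omega> (f n)" for n using fK[of n] by (simp add: K_def)
  obtain v k where k: "strict_mono (k :: nat \<Rightarrow> nat)" and vL: "L-lipschitz_on \<Omega> v"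
    and ul: "uniform_limit \<Omega> (\<lambda>n. f (k n)) v sequentially"
    using lipschitz_bounded_subsequence[of \<Omega> L f "L * R", OF compact fL Kb[OF fK]] by metis
  have "(\<lambda>n. f (k n) x0) \<longlonglongrightarrow> v x0"
    using ul x0 by (rule tendsto_uniform_limitI)
  moreover have "(\<lambda>n. f (k n) x0) = (\<lambda>n. 0)" using fK by (auto simp: K_def)
  ultimately have vx0: "v x0 = 0" using LIMSEQ_unique tendsto_const by metis
  have vK: "v \<in> K" using vL vx0 by (simp add: K_def)
  have max: "D v' \<le> D v" if "v' \<in> K" for v'
  proof (rule field_le_epsilon)
    fix d :: real assume d: "d > 0"
    have "\<forall>\<^sub>F n in sequentially. \<forall>z\<in>\<Omega>. dist (f (k n) z) (v z) < d / 4"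
      using d by (intro uniform_limitD[OF ul]) simp
    moreover have "\<forall>\<^sub>F n in sequentially. inverse (real (Suc (k n))) < d / 2"
      using LIMSEQ_subseq_LIMSEQ[OF LIMSEQ_inverse_real_of_nat k] d
      by (intro order_tendstoD(2)[of _ 0]) (auto simp: comp_def)
    ultimately have "\<forall>\<^sub>F n in sequentially. D v' \<le> D v + d"
    proof eventually_elim
      case (elim n)
      have "D v' \<le> s" unfolding s_def using that bdd by (rule cSUP_upper)
      also have "\<dots> \<le> D (f (k n)) + d / 2" using f[of "k n"] elim(2) by simp
      also have "D (f (k n)) \<le> D v + 2 * (d / 4)"
        using elim(1) by (intro D_le Kc fK vK) (simp add: dist_real_def less_imp_le)
      finally show ?case by simp
    qed
    then show "D v' \<le> D v + d" by simp
  qed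
  define u where "u = ?T v"
  define w where "w = ?S u"
  have v: "continuous_on \<Omega> v" using vK by (rule Kc)
  have u: "continuous_on \<Omega> u" unfolding u_def by (rule soft_conjugate_continuous[OF e v])
  have w: "continuous_on \<Omega> w" unfolding w_def by (rule S.soft_conjugate_continuous[OF e u])
  have Tw: "continuous_on \<Omega> (?T w)" by (rule soft_conjugate_continuous[OF e w])
  have wL: "L-lipschitz_on \<Omega> w" unfolding w_def by (rule S.soft_conjugate_lipschitz[OF e u])
  \<comment> \<open>The biconjugate \<open>w\<close> need not vanish at \<open>x0\<close>, but \<open>D\<close> is invariant under adding constants.\<close>
  define w0 where "w0 z = w z - w x0" for z
  have w0K: "w0 \<in> K" using wL by (auto simp: K_def w0_def lipschitz_on_def dist_real_def)
  have "integral\<^sup>L M (?T w) \<le> integral\<^sup>L M (?T w0) + - w x0"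
    by (rule prob_measures_integral_le_const_add[OF compact M Tw soft_conjugate_continuous[OF e Kc[OF w0K]]],
        rule soft_conjugate_le_add[OF e w Kc[OF w0K]]) (auto simp: w0_def)
  moreover have "integral\<^sup>L N w \<le> integral\<^sup>L N w0 + w x0"
    by (rule prob_measures_integral_le_const_add[OF compact N w Kc[OF w0K]]) (simp add: w0_def)
  ultimately have "D w \<le> D w0" by (simp add: D_def)
  also have "\<dots> \<le> D v" using w0K by (rule max)
  finally have "D w \<le> D v" .
  moreover have "integral\<^sup>L M u \<le> integral\<^sup>L M (?T w)"
    using integral_soft_biconjugate(1)[OF e u] by (simp add: w_def)
  moreover have "integral\<^sup>L N v \<le> integral\<^sup>L N w"
    using S.integral_soft_biconjugate(1)[OF e v] by (simp add: w_def u_def)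
  ultimately have "integral\<^sup>L N v = integral\<^sup>L N w"
    by (simp add: D_def u_def)
  then have "AE z in N. v z = w z"
    using S.integral_soft_biconjugate(2)[OF e v] by (simp add: w_def u_def)
  then show ?thesis
    using that[OF vL vx0] by (simp add: w_def u_def)
qed

text \<open>The Gibbs density of a fixed point has the right marginals: the first by the choice of \<open>u\<close>, the
  second by the fixed point equation. The entropy of this coupling relative to the product is
  nonnegative, which for \<open>t = (u + v - c) / e\<close> is the inequality \<open>\<integral> t exp t \<ge> \<integral> (exp t - 1) = 0\<close>; hence its
  cost is at most the value of the potentials.\<close>
lemma schroedinger_coupling:
  fixes e :: real and v
  assumes e: "e > 0" and v: "continuous_on \<Omega> v"
    and ae: "AE z in N. v z = soft_conjugate e M (\<lambda>z x. c x z) (soft_conjugate e N c v) z"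
  defines "u \<equiv> soft_conjugate e N c v"
  obtains \<gamma> where "\<gamma> \<in> couplings M N"
    "(\<integral>z. c (fst z) (snd z) \<partial>\<gamma>) \<le> integral\<^sup>L M u + integral\<^sup>L N v"
proof -
  interpret S: lipschitz_transport \<Omega> L "\<lambda>z x. c x z" N M by (rule swap)
  interpret P: pair_sigma_finite M N
    using prob_measuresD(3)[OF M] prob_measuresD(3)[OF N] by (simp add: pair_sigma_finite_def)
  have u: "continuous_on \<Omega> u" unfolding u_def by (rule soft_conjugate_continuous[OF e v])
  define t where "t p = (u (fst p) + v (snd p) - c (fst p) (snd p)) / e" for p
  have t: "continuous_on (\<Omega> \<times> \<Omega>) t"
    unfolding t_def by (rule gibbs_continuous[OF u v])
  note MN = pair_in_prob_measures[OF M N]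
  note comp2 = compact_Times[OF compact compact]
  note i = prob_measures_integrable[OF comp2 MN]
  have tm[measurable]: "(\<lambda>p. exp (t p)) \<in> borel_measurable (M \<Otimes>\<^sub>M N)"
    by (intro prob_measures_borel_measurable[OF MN] continuous_intros t)
  define \<gamma> where "\<gamma> = density (M \<Otimes>\<^sub>M N) (\<lambda>p. ennreal (exp (t p)))"
  have sg: "sets \<gamma> = sets (M \<Otimes>\<^sub>M N)" by (simp add: \<gamma>_def)
  have one: "(\<integral>z. exp (t (x, z)) \<partial>N) = 1" if "x \<in> \<Omega>" for x
    using exp_soft_conjugate[OF e v that, of "u x"] by (simp add: t_def u_def)
  have int1: "integrable N (\<lambda>z. exp (t (x, z)))" if "x \<in> \<Omega>" for x
    using that by (intro prob_measures_integrable[OF compact N] continuous_intros continuous_on_compose2[OF t]) auto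
  have int2: "integrable M (\<lambda>x. exp (t (x, z)))" if "z \<in> \<Omega>" for z
    using that by (intro prob_measures_integrable[OF compact M] continuous_intros continuous_on_compose2[OF t]) auto
  have fst: "distr \<gamma> M fst = M"
  proof (rule measure_eqI)
    fix A assume "A \<in> sets (distr \<gamma> M fst)"
    then have A[measurable]: "A \<in> sets M" by simp
    have fm: "fst \<in> measurable \<gamma> M" using measurable_fst measurable_cong_sets[OF sg refl] by blast
    have rect: "fst -` A \<inter> space \<gamma> = A \<times> space N"
      using sets.sets_into_space[OF A] by (auto simp: \<gamma>_def space_pair_measure)
    have "emeasure (distr \<gamma> M fst) A = emeasure \<gamma> (A \<times> space N)"
      using emeasure_distr[OF fm A] rect by simp
    also have "\<dots> = (\<integral>\<^sup>+p. ennreal (exp (t p)) * indicator (A \<times> space N) p \<partial>(M \<Otimes>\<^sub>M N))"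
      unfolding \<gamma>_def by (rule emeasure_density) auto
    also have "\<dots> = (\<integral>\<^sup>+x. (\<integral>\<^sup>+z. ennreal (exp (t (x, z))) * indicator (A \<times> space N) (x, z) \<partial>N) \<partial>M)"
      by (rule P.M2.nn_integral_fst[symmetric]) measurable
    also have "\<dots> = (\<integral>\<^sup>+x. indicator A x \<partial>M)"
    proof (rule nn_integral_cong)
      fix x assume "x \<in> space M"
      then have x: "x \<in> \<Omega>" using prob_measuresD(5)[OF M] by simp
      have "(\<integral>\<^sup>+z. ennreal (exp (t (x, z))) * indicator (A \<times> space N) (x, z) \<partial>N)
          = (\<integral>\<^sup>+z. ennreal (exp (t (x, z))) * indicator A x \<partial>N)"
        by (intro nn_integral_cong) (auto simp: indicator_def)
      also have "\<dots> = (\<integral>\<^sup>+z. ennreal (exp (t (x, z))) \<partial>N) * indicator A x"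
        using int1[OF x] by (intro nn_integral_multc) auto
      also have "(\<integral>\<^sup>+z. ennreal (exp (t (x, z))) \<partial>N) = 1"
        using nn_integral_eq_integral[OF int1[OF x]] one[OF x] by simp
      finally show "(\<integral>\<^sup>+z. ennreal (exp (t (x, z))) * indicator (A \<times> space N) (x, z) \<partial>N) = indicator A x"
        by simp
    qed
    also have "\<dots> = emeasure M A" by simp
    finally show "emeasure (distr \<gamma> M fst) A = emeasure M A" .
  qed simp
  have snd: "distr \<gamma> N snd = N"
  proof (rule measure_eqI)
    fix A assume "A \<in> sets (distr \<gamma> N snd)"
    then have A[measurable]: "A \<in> sets N" by simp
    have sm: "snd \<in> measurable \<gamma> N" using measurable_snd measurable_cong_sets[OF sg refl] by blast
    have rect: "snd -` A \<inter> space \<gamma> = space M \<times> A"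
      using sets.sets_into_space[OF A] by (auto simp: \<gamma>_def space_pair_measure)
    have "emeasure (distr \<gamma> N snd) A = emeasure \<gamma> (space M \<times> A)"
      using emeasure_distr[OF sm A] rect by simp
    also have "\<dots> = (\<integral>\<^sup>+p. ennreal (exp (t p)) * indicator (space M \<times> A) p \<partial>(M \<Otimes>\<^sub>M N))"
      unfolding \<gamma>_def by (rule emeasure_density) auto
    also have "\<dots> = (\<integral>\<^sup>+z. (\<integral>\<^sup>+x. ennreal (exp (t (x, z))) * indicator (space M \<times> A) (x, z) \<partial>M) \<partial>N)"
      by (rule P.nn_integral_snd[symmetric]) measurable
    also have "\<dots> = (\<integral>\<^sup>+z. indicator A z \<partial>N)"
    proof (rule nn_integral_cong_AE)
      show "AE z in N. (\<integral>\<^sup>+x. ennreal (exp (t (x, z))) * indicator (space M \<times> A) (x, z) \<partial>M) = indicator A z"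
        using ae AE_space
      proof eventually_elim
        case (elim z)
        then have z: "z \<in> \<Omega>" using prob_measuresD(5)[OF N] by simp
        have "(\<integral>\<^sup>+x. ennreal (exp (t (x, z))) * indicator (space M \<times> A) (x, z) \<partial>M)
            = (\<integral>\<^sup>+x. ennreal (exp (t (x, z))) * indicator A z \<partial>M)"
          by (intro nn_integral_cong) (auto simp: indicator_def)
        also have "\<dots> = (\<integral>\<^sup>+x. ennreal (exp (t (x, z))) \<partial>M) * indicator A z"
          using int2[OF z] by (intro nn_integral_multc) auto
        also have "(\<integral>\<^sup>+x. ennreal (exp (t (x, z))) \<partial>M) = ennreal (\<integral>x. exp (t (x, z)) \<partial>M)"
          by (rule nn_integral_eq_integral[OF int2[OF z]]) simp
        also have "(\<integral>x. exp (t (x, z)) \<partial>M) = exp ((v z - soft_conjugate e M (\<lambda>z x. c x z) u z) / e)"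
          unfolding S.exp_soft_conjugate[OF e u z] by (simp add: t_def add.commute)
        also have "\<dots> = 1"
          unfolding u_def elim(1)[symmetric] by simp
        finally show ?case by simp
      qed
    qed
    also have "\<dots> = emeasure N A" by simp
    finally show "emeasure (distr \<gamma> N snd) A = emeasure N A" .
  qed simp
  have g: "\<gamma> \<in> couplings M N"
    using sg fst snd by (simp add: couplings_def)
  note gP = couplings_in_prob_measures[OF M N g]
  have "(\<integral>p. exp (t p) \<partial>(M \<Otimes>\<^sub>M N)) = (\<integral>x. (\<integral>z. exp (t (x, z)) \<partial>N) \<partial>M)"
    using P.integral_fst'[of "\<lambda>p. exp (t p)"] i[OF continuous_on_exp[OF t]] by simp
  also have "\<dots> = (\<integral>x. 1 \<partial>M)"
    using one prob_measuresD(5)[OF M] by (intro Bochner_Integration.integral_cong) auto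
  finally have tot: "(\<integral>p. exp (t p) \<partial>(M \<Otimes>\<^sub>M N)) = 1"
    using prob_measures_measure_space[OF M] by simp
  have "(\<integral>p. exp (t p) - 1 \<partial>(M \<Otimes>\<^sub>M N)) = 0"
    using i[OF continuous_on_exp[OF t]] i[OF continuous_on_const[of _ 1]] tot prob_measures_measure_space[OF MN]
    by simp
  moreover have "(\<integral>p. exp (t p) - 1 \<partial>(M \<Otimes>\<^sub>M N)) \<le> (\<integral>p. exp (t p) * t p \<partial>(M \<Otimes>\<^sub>M N))"
  proof (rule prob_measures_integral_mono[OF comp2 MN])
    fix p
    have "exp (t p) * (1 + - t p) \<le> exp (t p) * exp (- t p)"
      by (intro mult_left_mono exp_ge_add_one_self) auto
    then show "exp (t p) - 1 \<le> exp (t p) * t p"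
      by (simp add: algebra_simps exp_minus_inverse)
  qed (intro continuous_intros t)+
  moreover have "(\<integral>p. exp (t p) * t p \<partial>(M \<Otimes>\<^sub>M N)) = (\<integral>p. t p \<partial>\<gamma>)"
    unfolding \<gamma>_def using prob_measures_borel_measurable[OF MN t]
    by (subst integral_density) auto
  ultimately have "0 \<le> e * (\<integral>p. t p \<partial>\<gamma>)" using e by simp
  also have "\<dots> = (\<integral>p. e * t p \<partial>\<gamma>)" by simp
  also have "\<dots> = (\<integral>p. u (fst p) + v (snd p) - c (fst p) (snd p) \<partial>\<gamma>)"
    using e by (simp add: t_def)
  also have "\<dots> = (\<integral>p. u (fst p) + v (snd p) \<partial>\<gamma>) - (\<integral>p. c (fst p) (snd p) \<partial>\<gamma>)"
    by (intro Bochner_Integration.integral_diff prob_measures_integrable[OF comp2 gP] cost_continuous)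
      (auto intro!: continuous_on_compose2[OF u] continuous_on_compose2[OF v] continuous_intros)
  finally show ?thesis
    using that[OF g] couplings_integral_marginals[OF compact M N g u v] by simp
qed

end

section \<open>Kantorovich duality for Lipschitz costs\<close>

lemma lipschitz_on_INF:
  fixes f :: "'a::metric_space \<Rightarrow> 'b \<Rightarrow> real"
  assumes I: "I \<noteq> {}" and L: "\<And>i. i \<in> I \<Longrightarrow> L-lipschitz_on S (\<lambda>x. f x i)"
    and bdd: "\<And>x. x \<in> S \<Longrightarrow> bdd_below (f x ` I)"
  shows "L-lipschitz_on S (\<lambda>x. INF i\<in>I. f x i)"
proof (rule lipschitz_onI)
  show "0 \<le> L" using I L lipschitz_on_nonneg by blast
  have one: "(INF i\<in>I. f x i) \<le> (INF i\<in>I. f y i) + L * dist x y" if "x \<in> S" "y \<in> S" for x y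
  proof -
    have "(INF i\<in>I. f x i) - L * dist x y \<le> (INF i\<in>I. f y i)"
    proof (rule cINF_greatest[OF I])
      fix i assume i: "i \<in> I"
      have "(INF i\<in>I. f x i) \<le> f x i" by (rule cINF_lower[OF bdd[OF that(1)] i])
      also have "\<dots> \<le> f y i + L * dist x y"
        using lipschitz_onD[OF L[OF i] that] by (simp add: dist_real_def)
      finally show "(INF i\<in>I. f x i) - L * dist x y \<le> f y i" by simp
    qed
    then show ?thesis by simp
  qed
  fix x y assume "x \<in> S" "y \<in> S"
  then show "dist (INF i\<in>I. f x i) (INF i\<in>I. f y i) \<le> L * dist x y"
    using one[of x y] one[of y x] by (simp add: dist_real_def abs_le_iff dist_commute)
qed

context lipschitz_transport
begin

text \<open>The soft potentials satisfy \<open>u x + v z \<le> c x z\<close> up to an error of order \<open>e\<close> in mean, because the positive part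
  of \<open>s\<close> is at most \<open>e exp (s / e)\<close> and the Gibbs density has mass one.\<close>
lemma entropic_excess_le:
  assumes e: "e > 0" and v: "continuous_on \<Omega> v" and x: "x \<in> \<Omega>"
  shows "(\<integral>z. max 0 (soft_conjugate e N c v x + v z - c x z) \<partial>N) \<le> e"
proof -
  let ?s = "\<lambda>z. soft_conjugate e N c v x + v z - c x z"
  have s: "continuous_on \<Omega> ?s"
    by (intro continuous_intros v cost_continuous_snd x)
  have "(\<integral>z. max 0 (?s z) \<partial>N) \<le> (\<integral>z. e * exp (?s z / e) \<partial>N)"
  proof (rule prob_measures_integral_mono[OF compact N])
    fix z
    have "?s z / e \<le> exp (?s z / e)" using exp_ge_add_one_self[of "?s z / e"] by linarith
    then show "max 0 (?s z) \<le> e * exp (?s z / e)" using e by (simp add: field_simps)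
  qed (use e in \<open>auto intro!: continuous_intros v cost_continuous_snd x\<close>)
  also have "\<dots> = e * exp ((soft_conjugate e N c v x - soft_conjugate e N c v x) / e)"
    unfolding exp_soft_conjugate[OF e v x] by simp
  finally show ?thesis by simp
qed

text \<open>The hard half of Kantorovich duality, with potentials that are attained and inherit the Lipschitz
  constant of the cost. They come from uniform limits \<open>u\<close>, \<open>v\<close>, along a subsequence, of solutions of the
  Schroedinger system for \<open>e = 1 / (n + 1)\<close>. The limit keeps the bound on the transport cost, whereas \<open>u x + v z \<le> c x z\<close> only
  survives for \<open>N\<close>-almost every \<open>z\<close>; replacing \<open>v\<close> by the \<open>c\<close>-transform of \<open>u\<close> repairs this and can only
  increase its integral.\<close>
theorem kantorovich_duality:
  assumes nonneg: "\<And>x z. x \<in> \<Omega> \<Longrightarrow> z \<in> \<Omega> \<Longrightarrow> 0 \<le> c x z"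
  obtains \<phi> \<psi> where "L-lipschitz_on \<Omega> \<phi>" "L-lipschitz_on \<Omega> \<psi>"
    "\<And>x z. x \<in> \<Omega> \<Longrightarrow> z \<in> \<Omega> \<Longrightarrow> \<phi> x + \<psi> z \<le> c x z"
    "transport_cost c M N \<le> integral\<^sup>L M \<phi> + integral\<^sup>L N \<psi>"
proof -
  obtain x0 where x0: "x0 \<in> \<Omega>" using prob_measures_nonempty[OF M] by blast
  define e where "e n = inverse (real (Suc n))" for n
  have e: "e n > 0" for n by (simp add: e_def)
  define P where "P n v \<longleftrightarrow> L-lipschitz_on \<Omega> v \<and> v x0 = 0 \<and>
    (AE z in N. v z = soft_conjugate (e n) M (\<lambda>z x. c x z) (soft_conjugate (e n) N c v) z)" for n v
  have "\<exists>v. P n v" for n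
    unfolding P_def using ex_schroedinger_potential[OF e x0, of n] by metis
  then obtain V where V: "\<And>n. P n (V n)" by metis
  have VL: "L-lipschitz_on \<Omega> (V n)" for n
    using V[of n] unfolding P_def by (rule conjunct1)
  have V0: "V n x0 = 0" for n
    using V[of n] unfolding P_def by (rule conjunct2[THEN conjunct1])
  have Vae: "AE z in N. V n z
      = soft_conjugate (e n) M (\<lambda>z x. c x z) (soft_conjugate (e n) N c (V n)) z" for n
    using V[of n] unfolding P_def by (rule conjunct2[THEN conjunct2])
  define U where "U n = soft_conjugate (e n) N c (V n)" for n
  have Vc: "continuous_on \<Omega> (V n)" for n using VL lipschitz_on_continuous_on by blast
  have UL: "L-lipschitz_on \<Omega> (U n)" for n unfolding U_def by (rule soft_conjugate_lipschitz[OF e Vc])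
  have Uc: "continuous_on \<Omega> (U n)" for n using UL lipschitz_on_continuous_on by blast
  obtain R where R: "\<And>z. z \<in> \<Omega> \<Longrightarrow> dist x0 z \<le> R"
    using compact_imp_bounded[OF compact] bounded_any_center[of \<Omega> x0] by auto
  have Vb: "\<bar>V n z\<bar> \<le> L * R" if "z \<in> \<Omega>" for n z
  proof -
    have "\<bar>V n z\<bar> = dist (V n x0) (V n z)" using V0 by (simp add: dist_real_def)
    also have "\<dots> \<le> L * dist x0 z" by (rule lipschitz_onD[OF VL x0 that])
    also have "\<dots> \<le> L * R" using R[OF that] L_nonneg by (rule mult_left_mono)
    finally show ?thesis .
  qed
  have "bounded ((\<lambda>p. c (fst p) (snd p)) ` (\<Omega> \<times> \<Omega>))"
    by (intro compact_imp_bounded compact_continuous_image cost_continuous compact_Times compact)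
  then obtain B where "\<forall>y\<in>(\<lambda>p. c (fst p) (snd p)) ` (\<Omega> \<times> \<Omega>). norm y \<le> B"
    unfolding bounded_iff by blast
  then have B: "\<bar>c x z\<bar> \<le> B" if "x \<in> \<Omega>" "z \<in> \<Omega>" for x z
    using that by simp
  have Ub: "\<bar>U n x\<bar> \<le> B + L * R" if x: "x \<in> \<Omega>" for n x
    unfolding U_def soft_conjugate_def
  proof (rule softmin_bound[OF compact N _ e])
    show "continuous_on \<Omega> (\<lambda>z. c x z - V n z)"
      by (intro continuous_intros Vc cost_continuous_snd x)
    show "\<bar>c x z - V n z\<bar> \<le> B + L * R" if "z \<in> \<Omega>" for z
      using B[OF x that] Vb[OF that, of n] by linarith
  qed
  obtain v k1 where k1: "strict_mono (k1 :: nat \<Rightarrow> nat)" and vL: "L-lipschitz_on \<Omega> v"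
    and vlim: "uniform_limit \<Omega> (\<lambda>n. V (k1 n)) v sequentially"
    using lipschitz_bounded_subsequence[of \<Omega> L V "L * R", OF compact VL Vb] by metis
  obtain u k2 where k2: "strict_mono (k2 :: nat \<Rightarrow> nat)" and uL: "L-lipschitz_on \<Omega> u"
    and ulim: "uniform_limit \<Omega> (\<lambda>n. U (k1 (k2 n))) u sequentially"
    using lipschitz_bounded_subsequence[of \<Omega> L "\<lambda>n. U (k1 n)" "B + L * R", OF compact UL Ub] by metis
  define k where "k n = k1 (k2 n)" for n
  have k: "strict_mono k" using strict_mono_o[OF k1 k2] by (simp add: k_def[abs_def] comp_def)
  have close: "\<exists>n. e n < d \<and> (\<forall>x\<in>\<Omega>. \<bar>U n x - u x\<bar> < d) \<and> (\<forall>z\<in>\<Omega>. \<bar>V n z - v z\<bar> < d)"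
    if d: "d > 0" for d
  proof -
    have "\<forall>\<^sub>F n in sequentially. \<forall>x\<in>\<Omega>. dist (U (k n) x) (u x) < d"
      using uniform_limitD[OF ulim d] by (simp add: k_def)
    moreover have "\<forall>\<^sub>F n in sequentially. \<forall>z\<in>\<Omega>. dist (V (k n) z) (v z) < d"
      using eventually_subseq[OF k2 uniform_limitD[OF vlim d]] by (simp add: k_def)
    moreover have "\<forall>\<^sub>F n in sequentially. e (k n) < d"
      using LIMSEQ_subseq_LIMSEQ[OF LIMSEQ_inverse_real_of_nat k] d
      by (intro order_tendstoD(2)[of _ 0]) (auto simp: comp_def e_def)
    ultimately have "\<forall>\<^sub>F n in sequentially. e (k n) < d \<and> (\<forall>x\<in>\<Omega>. dist (U (k n) x) (u x) < d)
        \<and> (\<forall>z\<in>\<Omega>. dist (V (k n) z) (v z) < d)"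
      by eventually_elim blast
    from eventually_happens[OF this] show ?thesis by (auto simp: dist_real_def)
  qed
  have uc: "continuous_on \<Omega> u" and vc: "continuous_on \<Omega> v"
    using uL vL lipschitz_on_continuous_on by blast+
  have cost_le: "transport_cost c M N \<le> integral\<^sup>L M u + integral\<^sup>L N v"
  proof (rule field_le_epsilon)
    fix d :: real assume "d > 0"
    then obtain n where n: "\<And>x. x \<in> \<Omega> \<Longrightarrow> \<bar>U n x - u x\<bar> < d / 2" "\<And>z. z \<in> \<Omega> \<Longrightarrow> \<bar>V n z - v z\<bar> < d / 2"
      using close[of "d / 2"] by auto
    have le1: "U n x \<le> u x + d / 2" and le2: "V n x \<le> v x + d / 2" if "x \<in> \<Omega>" for x
      using n(1)[OF that] n(2)[OF that] by linarith+
    obtain \<gamma> where g: "\<gamma> \<in> couplings M N"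
      and le: "(\<integral>z. c (fst z) (snd z) \<partial>\<gamma>) \<le> integral\<^sup>L M (U n) + integral\<^sup>L N (V n)"
      using schroedinger_coupling[OF e Vc Vae, of n, folded U_def] by metis
    have "transport_cost c M N \<le> integral\<^sup>L M (U n) + integral\<^sup>L N (V n)"
      using transport_cost_le[where c=c, OF M N g nonneg] le by simp
    also have "integral\<^sup>L M (U n) \<le> integral\<^sup>L M u + d / 2"
      by (rule prob_measures_integral_le_const_add[OF compact M Uc uc le1])
    also have "integral\<^sup>L N (V n) \<le> integral\<^sup>L N v + d / 2"
      by (rule prob_measures_integral_le_const_add[OF compact N Vc vc le2])
    finally show "transport_cost c M N \<le> integral\<^sup>L M u + integral\<^sup>L N v + d" by simp
  qed
  have ae1: "AE z in N. u x + v z \<le> c x z" if x: "x \<in> \<Omega>" for x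
  proof -
    let ?g = "\<lambda>z. max 0 (u x + v z - c x z)"
    have gc: "continuous_on \<Omega> ?g" by (intro continuous_intros vc cost_continuous_snd x)
    have "integral\<^sup>L N ?g \<le> 0"
    proof (rule field_le_epsilon)
      fix d :: real assume "d > 0"
      then obtain n where n: "e n < d / 3" "\<And>x. x \<in> \<Omega> \<Longrightarrow> \<bar>U n x - u x\<bar> < d / 3"
        "\<And>z. z \<in> \<Omega> \<Longrightarrow> \<bar>V n z - v z\<bar> < d / 3"
        using close[of "d / 3"] by auto
      have "integral\<^sup>L N ?g \<le> (\<integral>z. max 0 (U n x + V n z - c x z) \<partial>N) + 2 * d / 3"
      proof (rule prob_measures_integral_le_const_add[OF compact N gc])
        show "continuous_on \<Omega> (\<lambda>z. max 0 (U n x + V n z - c x z))"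
          by (intro continuous_intros Vc cost_continuous_snd x)
        show "?g z \<le> max 0 (U n x + V n z - c x z) + 2 * d / 3" if "z \<in> \<Omega>" for z
          using n(2)[OF x] n(3)[OF that] \<open>d > 0\<close> unfolding max_def by (split if_split)+ linarith
      qed
      also have "(\<integral>z. max 0 (U n x + V n z - c x z) \<partial>N) \<le> d / 3"
        using entropic_excess_le[OF e Vc x, of n n] n(1) by (simp add: U_def)
      finally show "integral\<^sup>L N ?g \<le> 0 + d" by simp
    qed
    moreover have "0 \<le> integral\<^sup>L N ?g"
      by (rule Bochner_Integration.integral_nonneg) simp
    ultimately have "integral\<^sup>L N ?g = 0" by simp
    then have "AE z in N. ?g z = 0"
      by (subst integral_nonneg_eq_0_iff_AE[symmetric])
        (auto intro!: prob_measures_integrable[OF compact N gc])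
    then show ?thesis by eventually_elim (simp add: max_def split: if_splits)
  qed
  \<comment> \<open>The exceptional null set depends on \<open>x\<close>; countably many \<open>x\<close> suffice by continuity.\<close>
  obtain Q where Q: "countable Q" "Q \<subseteq> \<Omega>" "\<Omega> \<subseteq> closure Q"
    using separable[of \<Omega>] by blast
  have clQ: "closure Q \<subseteq> \<Omega>"
    using Q(2) compact_imp_closed[OF compact] by (rule closure_minimal)
  have "AE z in N. \<forall>x\<in>Q. u x + v z \<le> c x z"
    using ae1 Q(1,2) by (intro AE_ball_countable[THEN iffD2]) auto
  then have ae: "AE z in N. \<forall>x\<in>\<Omega>. v z \<le> c x z - u x"
    using AE_space
  proof eventually_elim
    case (elim z)
    then have z: "z \<in> \<Omega>" using prob_measuresD(5)[OF N] by simp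
    show ?case
    proof
      fix x assume "x \<in> \<Omega>"
      have "continuous_on (closure Q) (\<lambda>x. u x - c x z)"
        by (rule continuous_on_subset[OF _ clQ]) (intro continuous_intros uc cost_continuous_fst z)
      moreover have "x \<in> closure Q" using Q(3) \<open>x \<in> \<Omega>\<close> by blast
      moreover have "\<And>x. x \<in> Q \<Longrightarrow> u x - c x z \<le> - v z" using elim(1) by force
      ultimately have "u x - c x z \<le> - v z" by (rule continuous_le_on_closure)
      then show "v z \<le> c x z - u x" by simp
    qed
  qed
  define \<psi> where "\<psi> z = (INF x\<in>\<Omega>. c x z - u x)" for z
  have bdd: "bdd_below ((\<lambda>x. c x z - u x) ` \<Omega>)" if "z \<in> \<Omega>" for z
    by (intro bounded_imp_bdd_below compact_imp_bounded compact_continuous_image compact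
        continuous_intros uc cost_continuous_fst that)
  have \<psi>L: "L-lipschitz_on \<Omega> \<psi>"
    unfolding \<psi>_def
  proof (rule lipschitz_on_INF[OF prob_measures_nonempty[OF M] _ bdd])
    show "L-lipschitz_on \<Omega> (\<lambda>z. c x z - u x)" if "x \<in> \<Omega>" for x
      using lipschitz_snd[OF that] by (auto simp: lipschitz_on_def dist_real_def)
  qed
  have "integral\<^sup>L N v \<le> integral\<^sup>L N \<psi>"
  proof (rule integral_mono_AE)
    show "integrable N v" "integrable N \<psi>"
      using vc \<psi>L by (auto intro!: prob_measures_integrable[OF compact N] lipschitz_on_continuous_on)
    show "AE z in N. v z \<le> \<psi> z"
      using ae by eventually_elim
        (auto simp: \<psi>_def intro!: cINF_greatest prob_measures_nonempty[OF M])
  qed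
  then have "transport_cost c M N \<le> integral\<^sup>L M u + integral\<^sup>L N \<psi>"
    using cost_le by simp
  moreover have "u x + \<psi> z \<le> c x z" if "x \<in> \<Omega>" "z \<in> \<Omega>" for x z
    using cINF_lower[OF bdd[OF that(2)] that(1)] by (simp add: \<psi>_def)
  ultimately show ?thesis using that[OF uL \<psi>L] by blast
qed

end

section \<open>The Huber cost\<close>

text \<open>For \<open>l, r \<ge> 0\<close> this is the Huber function: \<open>r\<^sup>2 / 2\<close> up to \<open>r = l\<close> and its tangent \<open>l r - l\<^sup>2 / 2\<close> from
  there on. In this form one sees the optimal way to pay for a distance \<open>r\<close>, namely quadratically for
  the last stretch of length at most \<open>l\<close> and linearly at rate \<open>l\<close> for the rest, so that
  \<open>huber l (dist x z)\<close> is the infimum over \<open>y\<close> of \<open>l * dist x y + (dist y z)\<^sup>2 / 2\<close>.\<close>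
definition huber :: "real \<Rightarrow> real \<Rightarrow> real" where
  "huber l r = (min r l)\<^sup>2 / 2 + l * max 0 (r - l)"

lemma huber_nonneg: "0 \<le> l \<Longrightarrow> 0 \<le> huber l r"
  by (simp add: huber_def)

lemma huber_le_half_square: "huber l r \<le> r\<^sup>2 / 2"
proof (cases "r \<le> l")
  case False
  have "0 \<le> (r - l)\<^sup>2" by simp
  then show ?thesis using False by (simp add: huber_def power2_eq_square algebra_simps)
qed (simp add: huber_def)

text \<open>Travelling the fraction \<open>t\<close> of the way at linear cost bounds the Huber cost, for \<open>0 \<le> t \<le> 1\<close>, by
  \<open>t l r + (1 - t)\<^sup>2 r\<^sup>2 / 2\<close>, and \<open>l r \<le> (l\<^sup>2 + r\<^sup>2) / 2\<close> turns this into the right-hand side. It is affine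
  in \<open>r\<^sup>2\<close> with a factor below \<open>1\<close> for \<open>0 < t < 1\<close>, which is what bounds \<open>W\<^sub>2\<close> by \<open>l\<close> at a minimiser.\<close>
lemma huber_le_interpolation:
  assumes "0 \<le> l" "0 \<le> r" "0 \<le> t"
  shows "huber l r \<le> (t * l\<^sup>2 + (1 - t + t\<^sup>2) * r\<^sup>2) / 2"
proof (cases "r \<le> l")
  case True
  then have "r\<^sup>2 \<le> l\<^sup>2" using assms by (intro power_mono)
  then have "0 \<le> t * (l\<^sup>2 - r\<^sup>2) + t\<^sup>2 * r\<^sup>2"
    using assms by simp
  then show ?thesis using True by (simp add: huber_def algebra_simps)
next
  case False
  \<comment> \<open>Completing the square in \<open>l\<close>: \<open>(1 + t) (1 - t + t\<^sup>2) = 1 + t\<^sup>3\<close>.\<close>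
  have "0 \<le> ((1 + t) * l - r)\<^sup>2 + t ^ 3 * r\<^sup>2"
    using assms by simp
  also have "\<dots> = (1 + t) * ((1 + t) * l\<^sup>2 - 2 * l * r + (1 - t + t\<^sup>2) * r\<^sup>2)"
    by (simp add: power2_eq_square power3_eq_cube algebra_simps)
  finally have "0 \<le> (1 + t) * l\<^sup>2 - 2 * l * r + (1 - t + t\<^sup>2) * r\<^sup>2"
    using assms(3) by (simp add: zero_le_mult_iff)
  then show ?thesis using False by (simp add: huber_def power2_eq_square algebra_simps)
qed

lemma huber_lipschitz:
  assumes "0 \<le> l" "0 \<le> r" "0 \<le> s"
  shows "\<bar>huber l r - huber l s\<bar> \<le> l * \<bar>r - s\<bar>"
proof -
  have one: "\<bar>huber l r - huber l s\<bar> \<le> l * (s - r)" if "0 \<le> r" "r \<le> s" for r s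
  proof -
    consider "s \<le> l" | "r \<le> l" "l < s" | "l < r" by linarith
    then show ?thesis
    proof cases
      case 1
      have "0 \<le> (s - r) * (s + r)" "0 \<le> (s - r) * (2 * l - (s + r))"
        using 1 that by (intro mult_nonneg_nonneg; simp)+
      then show ?thesis using 1 that by (simp add: huber_def power2_eq_square algebra_simps abs_le_iff)
    next
      case 2
      have "0 \<le> (l - r)\<^sup>2" "0 \<le> (l - r) * (l + r)" "0 \<le> l * (s - l)"
        using 2 that assms(1) by auto
      then show ?thesis using 2 by (simp add: huber_def power2_eq_square algebra_simps abs_le_iff)
    next
      case 3
      then show ?thesis using that assms(1) by (simp add: huber_def algebra_simps abs_le_iff mult_left_mono)
    qed
  qed
  show ?thesis
    using one[of r s] one[of s r] assms by (cases "r \<le> s") (auto simp: abs_minus_commute)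
qed

definition ball_projection :: "'a::euclidean_space \<Rightarrow> real \<Rightarrow> 'a \<Rightarrow> 'a" where
  "ball_projection z l x = z + min 1 (l / dist x z) *\<^sub>R (x - z)"

lemma dist_ball_projection:
  assumes "l > 0"
  shows "dist (ball_projection z l x) z = min (dist x z) l"
    and "dist (ball_projection z l x) x = max 0 (dist x z - l)"
proof -
  define k where "k = min 1 (l / dist x z)"
  have k: "0 \<le> k" "k \<le> 1" using assms by (auto simp: k_def)
  have "ball_projection z l x - x = (k - 1) *\<^sub>R (x - z)"
    by (simp add: ball_projection_def k_def algebra_simps)
  then have x: "dist (ball_projection z l x) x = (1 - k) * dist x z"
    using k by (simp add: dist_norm)
  have "ball_projection z l x - z = k *\<^sub>R (x - z)"
    by (simp add: ball_projection_def k_def)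
  then have z: "dist (ball_projection z l x) z = k * dist x z"
    using k by (simp add: dist_norm)
  have r: "k * dist x z = min (dist x z) l"
    using assms by (cases "x = z") (auto simp: k_def min_def field_simps)
  show "dist (ball_projection z l x) z = min (dist x z) l" using z r by simp
  show "dist (ball_projection z l x) x = max 0 (dist x z - l)"
    using x r by (simp add: left_diff_distrib min_def max_def split: if_splits)
qed

lemma ball_projection_in_convex:
  assumes "convex \<Omega>" "x \<in> \<Omega>" "z \<in> \<Omega>" "l > 0"
  shows "ball_projection z l x \<in> \<Omega>"
proof -
  have "(1 - min 1 (l / dist x z)) *\<^sub>R z + min 1 (l / dist x z) *\<^sub>R x \<in> \<Omega>"
    using assms by (intro convexD_alt) auto
  then show ?thesis by (simp add: ball_projection_def algebra_simps)
qed

lemma huber_dist_lipschitz: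
  assumes "0 \<le> l"
  shows "l-lipschitz_on S (\<lambda>x. huber l (dist x z))"
proof (rule lipschitz_onI[OF _ assms])
  fix x y
  have "dist (huber l (dist x z)) (huber l (dist y z)) \<le> l * \<bar>dist x z - dist y z\<bar>"
    using huber_lipschitz[OF assms] by (simp add: dist_real_def)
  also have "\<dots> \<le> l * dist x y"
    using abs_dist_diff_le[of x z y] assms by (intro mult_left_mono) (auto simp: dist_commute)
  finally show "dist (huber l (dist x z)) (huber l (dist y z)) \<le> l * dist x y" .
qed

text \<open>Given a plan that moves mass from \<open>x\<close> to \<open>z\<close>, stop it at the point \<open>y\<close> of the segment where the
  distance to \<open>z\<close> has dropped to at most \<open>l\<close>; convexity keeps \<open>y\<close> in \<open>\<Omega>\<close>. The law of \<open>y\<close> serves as the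
  competitor in the minimisation, and pairing \<open>y\<close> with \<open>x\<close> and with \<open>z\<close> under the same plan couples it with
  both \<open>\<nu>\<close> and \<open>\<mu>\<close>.\<close>
lemma split_cost_le_huber_cost:
  fixes \<nu> \<mu> :: "'a::euclidean_space measure"
  assumes "compact \<Omega>" "convex \<Omega>" and \<nu>: "\<nu> \<in> prob_measures \<Omega>" and \<mu>: "\<mu> \<in> prob_measures \<Omega>"
    and l: "l > 0" and g: "\<gamma> \<in> couplings \<nu> \<mu>"
  obtains \<rho> where "\<rho> \<in> prob_measures \<Omega>"
    "1/2 * (wasserstein 2 \<rho> \<mu>)\<^sup>2 + l * wasserstein 1 \<rho> \<nu> \<le> (\<integral>p. huber l (dist (fst p) (snd p)) \<partial>\<gamma>)"
proof -
  note gP = couplings_in_prob_measures[OF \<nu> \<mu> g]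
  note m = couplings_measurable[OF g]
  note int = prob_measures_integrable[OF compact_Times[OF assms(1,1)] gP]
  define y where "y p = ball_projection (snd p) l (fst p)" for p :: "'a \<times> 'a"
  define \<rho> where "\<rho> = distr \<gamma> (restrict_space borel \<Omega>) y"
  have [measurable]: "fst \<in> borel_measurable \<gamma>"
    by (rule measurable_compose[OF m(1) prob_measures_id_borel[OF \<nu>]])
  have [measurable]: "snd \<in> borel_measurable \<gamma>"
    by (rule measurable_compose[OF m(2) prob_measures_id_borel[OF \<mu>]])
  have yb: "y \<in> borel_measurable \<gamma>"
    unfolding y_def[abs_def] ball_projection_def by measurable
  have y\<Omega>: "y p \<in> \<Omega>" if "p \<in> space \<gamma>" for p
  proof -
    have "p \<in> \<Omega> \<times> \<Omega>" using that by (simp only: prob_measuresD(5)[OF gP])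
    then have "fst p \<in> \<Omega>" "snd p \<in> \<Omega>" by auto
    then show ?thesis unfolding y_def by (rule ball_projection_in_convex[OF assms(2) _ _ l])
  qed
  have yr: "y \<in> measurable \<gamma> (restrict_space borel \<Omega>)"
    using y\<Omega> by (intro measurable_restrict_space2[OF _ yb] funcsetI)
  have \<rho>: "\<rho> \<in> prob_measures \<Omega>"
    using prob_space.prob_space_distr[OF prob_measuresD(1)[OF gP] yr]
    by (simp add: prob_measures_def \<rho>_def)
  have y\<rho>: "y \<in> measurable \<gamma> \<rho>"
    by (rule prob_measures_measurableI[OF \<rho> yb y\<Omega>])
  have dy: "distr \<gamma> \<rho> y = \<rho>"
  proof -
    have "distr \<gamma> \<rho> y = distr \<gamma> (restrict_space borel \<Omega>) y"
      by (rule distr_cong[OF refl prob_measuresD(4)[OF \<rho>] refl])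
    then show ?thesis by (simp only: \<rho>_def[symmetric])
  qed
  have d: "distr \<gamma> \<nu> fst = \<nu>" "distr \<gamma> \<mu> snd = \<mu>"
    using g by (auto simp: couplings_def)
  have "(wasserstein 2 \<rho> \<mu>)\<^sup>2 \<le> (\<integral>p. (dist (y p) (snd p))\<^sup>2 \<partial>\<gamma>)"
    unfolding wasserstein_2_sq_eq[OF \<rho> \<mu>]
    by (rule transport_cost_random_variables_le[OF \<rho> \<mu> _ _ y\<rho> m(2) dy d(2)])
      (auto intro!: continuous_intros)
  also have "\<dots> = (\<integral>p. (min (dist (fst p) (snd p)) l)\<^sup>2 \<partial>\<gamma>)"
    by (simp add: y_def dist_ball_projection[OF l])
  finally have W2: "(wasserstein 2 \<rho> \<mu>)\<^sup>2 \<le> (\<integral>p. (min (dist (fst p) (snd p)) l)\<^sup>2 \<partial>\<gamma>)" .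
  have "wasserstein 1 \<rho> \<nu> \<le> (\<integral>p. dist (y p) (fst p) \<partial>\<gamma>)"
    unfolding wasserstein_1_eq[OF \<rho> \<nu>]
    by (rule transport_cost_random_variables_le[OF \<rho> \<nu> _ _ y\<rho> m(1) dy d(1)])
      (auto intro!: continuous_intros)
  also have "\<dots> = (\<integral>p. max 0 (dist (fst p) (snd p) - l) \<partial>\<gamma>)"
    by (simp add: y_def dist_ball_projection[OF l])
  finally have W1: "l * wasserstein 1 \<rho> \<nu> \<le> l * (\<integral>p. max 0 (dist (fst p) (snd p) - l) \<partial>\<gamma>)"
    using l by simp
  have i2: "integrable \<gamma> (\<lambda>p. (min (dist (fst p) (snd p)) l)\<^sup>2 / 2)"
    by (intro int continuous_intros) auto
  have i1: "integrable \<gamma> (\<lambda>p. l * max 0 (dist (fst p) (snd p) - l))"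
    by (intro int continuous_intros)
  have "(\<integral>p. huber l (dist (fst p) (snd p)) \<partial>\<gamma>)
      = (\<integral>p. (min (dist (fst p) (snd p)) l)\<^sup>2 \<partial>\<gamma>) / 2 + l * (\<integral>p. max 0 (dist (fst p) (snd p) - l) \<partial>\<gamma>)"
    using Bochner_Integration.integral_add[OF i2 i1] by (simp add: huber_def)
  then show ?thesis using that[OF \<rho>] W1 W2 by simp
qed

section \<open>The minimisation step\<close>

lemma kantorovich_potentials_le_half_W2_sq:
  assumes "compact \<Omega>" "\<sigma> \<in> prob_measures \<Omega>" "\<mu> \<in> prob_measures \<Omega>"
    and "continuous_on \<Omega> \<phi>" "continuous_on \<Omega> \<psi>"
    and le: "\<And>x z. x \<in> \<Omega> \<Longrightarrow> z \<in> \<Omega> \<Longrightarrow> \<phi> x + \<psi> z \<le> (dist x z)\<^sup>2 / 2"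
  shows "integral\<^sup>L \<sigma> \<phi> + integral\<^sup>L \<mu> \<psi> \<le> 1/2 * (wasserstein 2 \<sigma> \<mu>)\<^sup>2"
proof -
  have "(\<integral>x. 2 * \<phi> x \<partial>\<sigma>) + (\<integral>z. 2 * \<psi> z \<partial>\<mu>) \<le> transport_cost (\<lambda>x y. (dist x y)\<^sup>2) \<sigma> \<mu>"
    by (rule transport_cost_dual_le[OF assms(1-3)])
      (use le in \<open>auto intro!: continuous_intros assms simp: field_simps\<close>)
  then show ?thesis by (simp add: wasserstein_2_sq_eq[OF assms(2,3)])
qed

lemma lipschitz_integral_diff_le_W1:
  assumes "compact \<Omega>" "\<sigma> \<in> prob_measures \<Omega>" "\<tau> \<in> prob_measures \<Omega>"
    and "l > 0" "l-lipschitz_on \<Omega> \<phi>"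
  shows "integral\<^sup>L \<sigma> \<phi> - integral\<^sup>L \<tau> \<phi> \<le> l * wasserstein 1 \<sigma> \<tau>"
proof -
  have c: "continuous_on \<Omega> \<phi>" using assms(5) lipschitz_on_continuous_on by blast
  have "(\<integral>x. \<phi> x / l \<partial>\<sigma>) + (\<integral>z. - \<phi> z / l \<partial>\<tau>) \<le> transport_cost dist \<sigma> \<tau>"
  proof (rule transport_cost_dual_le[OF assms(1-3)])
    fix x y assume xy: "x \<in> \<Omega>" "y \<in> \<Omega>"
    have "\<phi> x - \<phi> y \<le> l * dist x y"
      using lipschitz_onD[OF assms(5) xy] by (simp add: dist_real_def)
    then show "\<phi> x / l + - \<phi> y / l \<le> dist x y" using assms(4) by (simp add: field_simps)
  qed (use assms(4) in \<open>auto intro!: continuous_intros c\<close>)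
  then show ?thesis using assms(4) by (simp add: wasserstein_1_eq[OF assms(2,3)] field_simps)
qed

text \<open>Dual potentials for the Huber cost are optimal for both parts of the minimisation at once. The
  minimal value is at most the Huber transport cost, hence at most
  \<open>\<integral> \<phi> d\<nu> + \<integral> \<psi> d\<mu> = (\<integral> \<phi> d\<rho> + \<integral> \<psi> d\<mu>) + (\<integral> \<phi> d\<nu> - \<integral> \<phi> d\<rho>)\<close>, whereas the first bracket is at most
  \<open>W\<^sub>2\<^sup>2(\<rho>, \<mu>) / 2\<close> because the Huber cost lies below \<open>r\<^sup>2 / 2\<close>, and the second is at most \<open>l W\<^sub>1(\<nu>, \<rho>)\<close> because \<open>\<phi>\<close>
  is \<open>l\<close>-Lipschitz. So both are equalities.\<close>
lemma proximal_step_potentials: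
  fixes \<nu> \<mu> \<rho> :: "'a::euclidean_space measure"
  assumes \<Omega>: "compact \<Omega>" "convex \<Omega>" and \<nu>: "\<nu> \<in> prob_measures \<Omega>" and \<mu>: "\<mu> \<in> prob_measures \<Omega>"
    and l: "l > 0" and \<rho>: "\<rho> \<in> prob_measures \<Omega>"
    and min: "\<And>\<sigma>. \<sigma> \<in> prob_measures \<Omega> \<Longrightarrow>
        1/2 * (wasserstein 2 \<rho> \<mu>)\<^sup>2 + l * wasserstein 1 \<rho> \<nu> \<le> 1/2 * (wasserstein 2 \<sigma> \<mu>)\<^sup>2 + l * wasserstein 1 \<sigma> \<nu>"
  obtains \<phi> \<psi> where "l-lipschitz_on \<Omega> \<phi>" "l-lipschitz_on \<Omega> \<psi>"
    "\<And>x z. x \<in> \<Omega> \<Longrightarrow> z \<in> \<Omega> \<Longrightarrow> \<phi> x + \<psi> z \<le> huber l (dist x z)"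
    "1/2 * (wasserstein 2 \<rho> \<mu>)\<^sup>2 = integral\<^sup>L \<rho> \<phi> + integral\<^sup>L \<mu> \<psi>"
    "l * wasserstein 1 \<nu> \<rho> = integral\<^sup>L \<nu> \<phi> - integral\<^sup>L \<rho> \<phi>"
proof -
  let ?h = "\<lambda>x z. huber l (dist x z)"
  have hl: "l-lipschitz_on \<Omega> (?h x)" for x
    using huber_dist_lipschitz[of l \<Omega> x] l by (simp add: dist_commute)
  interpret T: lipschitz_transport \<Omega> l ?h \<nu> \<mu>
    using huber_dist_lipschitz[OF less_imp_le[OF l]] hl by unfold_locales (use \<Omega> \<nu> \<mu> in auto)
  obtain \<phi> \<psi> where \<phi>: "l-lipschitz_on \<Omega> \<phi>" and \<psi>: "l-lipschitz_on \<Omega> \<psi>"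
    and le: "\<And>x z. x \<in> \<Omega> \<Longrightarrow> z \<in> \<Omega> \<Longrightarrow> \<phi> x + \<psi> z \<le> ?h x z"
    and dual: "transport_cost ?h \<nu> \<mu> \<le> integral\<^sup>L \<nu> \<phi> + integral\<^sup>L \<mu> \<psi>"
    using T.kantorovich_duality huber_nonneg l by (metis less_imp_le)
  have "1/2 * (wasserstein 2 \<rho> \<mu>)\<^sup>2 + l * wasserstein 1 \<rho> \<nu> \<le> transport_cost ?h \<nu> \<mu>"
  proof (rule transport_cost_ge[OF \<nu> \<mu>])
    fix \<gamma> assume "\<gamma> \<in> couplings \<nu> \<mu>"
    then obtain \<sigma> where s: "\<sigma> \<in> prob_measures \<Omega>"
      "1/2 * (wasserstein 2 \<sigma> \<mu>)\<^sup>2 + l * wasserstein 1 \<sigma> \<nu> \<le> (\<integral>p. huber l (dist (fst p) (snd p)) \<partial>\<gamma>)"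
      by (rule split_cost_le_huber_cost[OF \<Omega> \<nu> \<mu> l])
    show "1/2 * (wasserstein 2 \<rho> \<mu>)\<^sup>2 + l * wasserstein 1 \<rho> \<nu> \<le> (\<integral>p. huber l (dist (fst p) (snd p)) \<partial>\<gamma>)"
      using min[OF s(1)] s(2) by linarith
  qed
  then have total: "1/2 * (wasserstein 2 \<rho> \<mu>)\<^sup>2 + l * wasserstein 1 \<nu> \<rho> \<le> integral\<^sup>L \<nu> \<phi> + integral\<^sup>L \<mu> \<psi>"
    using dual wasserstein_commute[OF \<rho> \<nu>, of 1] by simp
  have "integral\<^sup>L \<rho> \<phi> + integral\<^sup>L \<mu> \<psi> \<le> 1/2 * (wasserstein 2 \<rho> \<mu>)\<^sup>2"
    using order_trans[OF le huber_le_half_square] lipschitz_on_continuous_on[OF \<phi>] lipschitz_on_continuous_on[OF \<psi>]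
    by (intro kantorovich_potentials_le_half_W2_sq[OF \<Omega>(1) \<rho> \<mu>])
  moreover have "integral\<^sup>L \<nu> \<phi> - integral\<^sup>L \<rho> \<phi> \<le> l * wasserstein 1 \<nu> \<rho>"
    by (rule lipschitz_integral_diff_le_W1[OF \<Omega>(1) \<nu> \<rho> l \<phi>])
  ultimately show ?thesis
    using that[OF \<phi> \<psi> le] total by linarith
qed

text \<open>The infimum in the definition runs over a singleton, since a measure is determined by its
  sigma-algebra and its values.\<close>
lemma half_W2_sq_measure:
  assumes "\<sigma> \<in> prob_measures \<Omega>"
  shows "half_W2_sq \<Omega> \<mu> (measure \<sigma>) = ereal (1/2 * (wasserstein 2 \<sigma> \<mu>)\<^sup>2)"
proof -
  have "\<sigma>' = \<sigma>" if "\<sigma>' \<in> prob_measures \<Omega>" "measure \<sigma>' = measure \<sigma>" for \<sigma>'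
  proof (rule measure_eqI)
    show "sets \<sigma>' = sets \<sigma>"
      using prob_measuresD(4)[OF that(1)] prob_measuresD(4)[OF assms] by simp
    show "emeasure \<sigma>' A = emeasure \<sigma> A" for A
      using that(2) finite_measure.emeasure_eq_measure[OF prob_measuresD(2)[OF that(1)]]
        finite_measure.emeasure_eq_measure[OF prob_measuresD(2)[OF assms]] by simp
  qed
  then have "{\<sigma>' \<in> prob_measures \<Omega>. measure \<sigma>' = measure \<sigma>} = {\<sigma>}"
    using assms by auto
  then show ?thesis by (simp add: half_W2_sq_def)
qed

lemma signed_integral_prob_measures:
  assumes "compact \<Omega>" "continuous_on \<Omega> \<phi>" "\<sigma> \<in> prob_measures \<Omega>" "\<rho> \<in> prob_measures \<Omega>"
  shows "signed_integral \<Omega> (measure \<sigma> - measure \<rho>) \<phi> = integral\<^sup>L \<sigma> \<phi> - integral\<^sup>L \<rho> \<phi>"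
  using assms prob_measuresD(2,4)[OF assms(3)] prob_measuresD(2,4)[OF assms(4)]
  by (intro signed_integral_diff) (auto simp: finite_measures_def)

text \<open>The potentials bound the functional below by the affine functional \<open>\<sigma> \<mapsto> \<integral> \<phi> d\<sigma> + \<integral> \<psi> d\<mu>\<close>, which touches it
  at \<open>\<rho>\<close>.\<close>
lemma optimal_potential_in_subdifferential:
  assumes \<Omega>: "compact \<Omega>" and \<mu>: "\<mu> \<in> prob_measures \<Omega>" and \<rho>: "\<rho> \<in> prob_measures \<Omega>"
    and \<phi>: "continuous_on \<Omega> \<phi>" and \<psi>: "continuous_on \<Omega> \<psi>"
    and le: "\<And>x z. x \<in> \<Omega> \<Longrightarrow> z \<in> \<Omega> \<Longrightarrow> \<phi> x + \<psi> z \<le> (dist x z)\<^sup>2 / 2"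
    and opt: "1/2 * (wasserstein 2 \<rho> \<mu>)\<^sup>2 = integral\<^sup>L \<rho> \<phi> + integral\<^sup>L \<mu> \<psi>"
  shows "\<phi> \<in> subdifferential \<Omega> (half_W2_sq \<Omega> \<mu>) (measure \<rho>)"
  unfolding subdifferential_def
proof (intro CollectI conjI ballI \<phi>)
  fix m
  show "half_W2_sq \<Omega> \<mu> (measure \<rho>) + ereal (signed_integral \<Omega> (m - measure \<rho>) \<phi>) \<le> half_W2_sq \<Omega> \<mu> m"
    unfolding half_W2_sq_measure[OF \<rho>] unfolding half_W2_sq_def
  proof (rule INF_greatest)
    fix \<sigma> assume "\<sigma> \<in> {\<sigma> \<in> prob_measures \<Omega>. measure \<sigma> = m}"
    then have \<sigma>: "\<sigma> \<in> prob_measures \<Omega>" and m: "m = measure \<sigma>" by auto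
    show "ereal (1/2 * (wasserstein 2 \<rho> \<mu>)\<^sup>2) + ereal (signed_integral \<Omega> (m - measure \<rho>) \<phi>)
        \<le> ereal (1/2 * (wasserstein 2 \<sigma> \<mu>)\<^sup>2)"
    proof -
      have "1/2 * (wasserstein 2 \<rho> \<mu>)\<^sup>2 + (integral\<^sup>L \<sigma> \<phi> - integral\<^sup>L \<rho> \<phi>) \<le> 1/2 * (wasserstein 2 \<sigma> \<mu>)\<^sup>2"
        using kantorovich_potentials_le_half_W2_sq[OF \<Omega> \<sigma> \<mu> \<phi> \<psi> le] opt by linarith
      then show ?thesis
        unfolding m signed_integral_prob_measures[OF \<Omega> \<phi> \<sigma> \<rho>]
        by (simp only: plus_ereal.simps ereal_less_eq)
    qed
  qed
qed

text \<open>The two facts about one step that the theorem iterates. For the first, the optimal potentials for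
  \<open>\<rho>\<close> and \<open>\<mu>\<close> even lie below the Huber cost, so \<open>W\<^sub>2\<^sup>2 = W\<^sub>2\<^sup>2(\<rho>, \<mu>)\<close> satisfies
  \<open>W\<^sub>2\<^sup>2 \<le> t l\<^sup>2 + (1 - t + t\<^sup>2) W\<^sub>2\<^sup>2\<close>; divide by \<open>t\<close> and let \<open>t\<close> tend to \<open>0\<close>. For the second, every
  \<open>l\<close>-Lipschitz function contributes at most \<open>l W\<^sub>1(\<nu>, \<rho>)\<close> to the supremum in \<open>D_lip\<close>, and the optimal
  potential attains this value.\<close>
lemma proximal_step:
  fixes \<nu> \<mu> \<rho> :: "'a::euclidean_space measure"
  assumes \<Omega>: "compact \<Omega>" "convex \<Omega>" and \<nu>: "\<nu> \<in> prob_measures \<Omega>" and \<mu>: "\<mu> \<in> prob_measures \<Omega>"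
    and l: "l > 0"
    and min: "is_arg_min (\<lambda>\<rho>. 1/2 * (wasserstein 2 \<rho> \<mu>)\<^sup>2 + l * wasserstein 1 \<rho> \<nu>)
           (\<lambda>\<rho>. \<rho> \<in> prob_measures \<Omega>) \<rho>"
  shows "(wasserstein 2 \<rho> \<mu>)\<^sup>2 \<le> l\<^sup>2"
    and "D_lip \<Omega> \<mu> l \<nu> \<rho> + ereal (l * wasserstein 1 \<nu> \<rho>)
      = ereal (1/2 * (wasserstein 2 \<nu> \<mu>)\<^sup>2 - 1/2 * (wasserstein 2 \<rho> \<mu>)\<^sup>2)"
proof -
  have \<rho>: "\<rho> \<in> prob_measures \<Omega>" using min by (simp add: is_arg_min_def)
  obtain \<phi> \<psi> where \<phi>: "l-lipschitz_on \<Omega> \<phi>" and \<psi>: "l-lipschitz_on \<Omega> \<psi>"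
    and le: "\<And>x z. x \<in> \<Omega> \<Longrightarrow> z \<in> \<Omega> \<Longrightarrow> \<phi> x + \<psi> z \<le> huber l (dist x z)"
    and W2: "1/2 * (wasserstein 2 \<rho> \<mu>)\<^sup>2 = integral\<^sup>L \<rho> \<phi> + integral\<^sup>L \<mu> \<psi>"
    and W1: "l * wasserstein 1 \<nu> \<rho> = integral\<^sup>L \<nu> \<phi> - integral\<^sup>L \<rho> \<phi>"
  proof (rule proximal_step_potentials[OF \<Omega> \<nu> \<mu> l \<rho>])
    fix \<sigma> assume "\<sigma> \<in> prob_measures \<Omega>"
    then show "1/2 * (wasserstein 2 \<rho> \<mu>)\<^sup>2 + l * wasserstein 1 \<rho> \<nu>
        \<le> 1/2 * (wasserstein 2 \<sigma> \<mu>)\<^sup>2 + l * wasserstein 1 \<sigma> \<nu>"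
      using min by (simp add: is_arg_min_linorder)
  qed blast
  have \<phi>c: "continuous_on \<Omega> \<phi>" and \<psi>c: "continuous_on \<Omega> \<psi>"
    using \<phi> \<psi> lipschitz_on_continuous_on by blast+
  let ?W = "(wasserstein 2 \<rho> \<mu>)\<^sup>2"
  show "?W \<le> l\<^sup>2"
  proof (rule field_le_mult_one_interval)
    fix s :: real assume s: "0 < s" "s < 1"
    define t where "t = 1 - s"
    define q where "q = 1 - t + t\<^sup>2"
    have t: "0 < t" and q: "0 < q"
      using s by (auto simp: t_def q_def add_pos_nonneg)
    have "(\<integral>x. (2 * \<phi> x - t * l\<^sup>2) / q \<partial>\<rho>) + (\<integral>z. 2 * \<psi> z / q \<partial>\<mu>) \<le> transport_cost (\<lambda>x y. (dist x y)\<^sup>2) \<rho> \<mu>"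
    proof (rule transport_cost_dual_le[OF \<Omega>(1) \<rho> \<mu>])
      fix x z assume "x \<in> \<Omega>" "z \<in> \<Omega>"
      then have "\<phi> x + \<psi> z \<le> (t * l\<^sup>2 + q * (dist x z)\<^sup>2) / 2"
        using le[of x z] huber_le_interpolation[of l "dist x z" t] l t by (simp add: q_def)
      then show "(2 * \<phi> x - t * l\<^sup>2) / q + 2 * \<psi> z / q \<le> (dist x z)\<^sup>2"
        using q by (simp add: field_simps)
    qed (use q in \<open>auto intro!: continuous_intros \<phi>c \<psi>c\<close>)
    moreover have "(\<integral>x. 2 * \<phi> x - t * l\<^sup>2 \<partial>\<rho>) = 2 * integral\<^sup>L \<rho> \<phi> - t * l\<^sup>2"
      using prob_measures_integrable[OF \<Omega>(1) \<rho> \<phi>c]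
        prob_measures_integrable[OF \<Omega>(1) \<rho> continuous_on_const[of _ "t * l\<^sup>2"]]
      by (simp add: prob_measures_measure_space[OF \<rho>])
    ultimately have "(2 * integral\<^sup>L \<rho> \<phi> - t * l\<^sup>2) / q + 2 * integral\<^sup>L \<mu> \<psi> / q \<le> ?W"
      by (simp add: wasserstein_2_sq_eq[OF \<rho> \<mu>])
    then have "(?W - t * l\<^sup>2) / q \<le> ?W"
      using W2 by (simp add: add_divide_distrib[symmetric] algebra_simps)
    then have "?W - t * l\<^sup>2 \<le> q * ?W"
      using q by (simp add: field_simps)
    then have "t * ((1 - t) * ?W) \<le> t * l\<^sup>2"
      by (simp add: q_def power2_eq_square algebra_simps)
    then show "s * ?W \<le> l\<^sup>2" using t by (simp add: t_def)
  qed
  let ?S = "{\<phi> \<in> subdifferential \<Omega> (half_W2_sq \<Omega> \<mu>) (measure \<rho>). l-lipschitz_on \<Omega> \<phi>}"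
  have "(SUP \<phi>\<in>?S. ereal (signed_integral \<Omega> (measure \<nu> - measure \<rho>) \<phi>)) = ereal (l * wasserstein 1 \<nu> \<rho>)"
  proof (rule antisym)
    show "(SUP \<phi>\<in>?S. ereal (signed_integral \<Omega> (measure \<nu> - measure \<rho>) \<phi>)) \<le> ereal (l * wasserstein 1 \<nu> \<rho>)"
    proof (rule SUP_least)
      fix \<phi>' assume "\<phi>' \<in> ?S"
      then have "continuous_on \<Omega> \<phi>'" "l-lipschitz_on \<Omega> \<phi>'"
        by (auto simp: subdifferential_def)
      then show "ereal (signed_integral \<Omega> (measure \<nu> - measure \<rho>) \<phi>') \<le> ereal (l * wasserstein 1 \<nu> \<rho>)"
        using lipschitz_integral_diff_le_W1[OF \<Omega>(1) \<nu> \<rho> l]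
        by (simp add: signed_integral_prob_measures[OF \<Omega>(1) _ \<nu> \<rho>])
    qed
    have "\<phi> \<in> ?S"
      using \<phi> optimal_potential_in_subdifferential[OF \<Omega>(1) \<mu> \<rho> \<phi>c \<psi>c order_trans[OF le huber_le_half_square] W2]
      by simp
    then show "ereal (l * wasserstein 1 \<nu> \<rho>) \<le> (SUP \<phi>\<in>?S. ereal (signed_integral \<Omega> (measure \<nu> - measure \<rho>) \<phi>))"
      by (rule SUP_upper2) (simp add: W1 signed_integral_prob_measures[OF \<Omega>(1) \<phi>c \<nu> \<rho>])
  qed
  then show "D_lip \<Omega> \<mu> l \<nu> \<rho> + ereal (l * wasserstein 1 \<nu> \<rho>)
      = ereal (1/2 * (wasserstein 2 \<nu> \<mu>)\<^sup>2 - 1/2 * (wasserstein 2 \<rho> \<mu>)\<^sup>2)"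
    by (simp add: D_lip_def)
qed

section \<open>The iterated scheme\<close>

theorem theorem1p10:
  fixes \<Omega> :: "'a::euclidean_space set"
    and \<mu> \<nu> :: "'a measure"
    and lam :: "nat \<Rightarrow> real"
    and nu :: "nat \<Rightarrow> 'a measure"
  assumes "compact \<Omega>" and "convex \<Omega>" and "\<not> negligible (interior \<Omega>)"
    and "\<mu> \<in> prob_measures \<Omega>" and "\<nu> \<in> prob_measures \<Omega>"
    and "absolutely_continuous (restrict_space lborel \<Omega>) \<mu>"
    and "lam 0 > 0" and "\<And>n. lam (Suc n) = lam n / 2"
    and "nu 0 = \<nu>"
    and "\<And>n. is_arg_min
           (\<lambda>\<rho>. 1/2 * (wasserstein 2 \<rho> \<mu>)\<^sup>2 + lam n * wasserstein 1 \<rho> (nu n))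
           (\<lambda>\<rho>. \<rho> \<in> prob_measures \<Omega>) (nu (Suc n))"
  shows "(\<lambda>n. wasserstein 2 \<mu> (nu n)) \<longlonglongrightarrow> 0
       \<and> (\<forall>n\<ge>1. 1/2 * (wasserstein 2 \<mu> (nu n))\<^sup>2 \<le> 2 powr (- 2 * real n + 1) * (lam 0)\<^sup>2)
       \<and> (\<lambda>n. D_lip \<Omega> \<mu> (lam n) (nu n) (nu (Suc n))
              + ereal (lam n * wasserstein 1 (nu n) (nu (Suc n))))
           sums ereal (1/2 * (wasserstein 2 \<nu> \<mu>)\<^sup>2)"
proof -
  have P: "nu n \<in> prob_measures \<Omega>" for n
  proof (cases n)
    case 0
    then show ?thesis by (simp only: assms(5,9))
  next
    case (Suc m)
    show ?thesis using assms(10)[of m] unfolding is_arg_min_def Suc by (rule conjunct1)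
  qed
  define l0 where "l0 = lam 0"
  have lam: "lam n = l0 / 2 ^ n" for n
    by (induction n) (simp_all add: assms(8) l0_def)
  have lam_pos: "lam n > 0" for n
    using assms(7) unfolding lam by simp
  have comm: "wasserstein 2 \<mu> (nu n) = wasserstein 2 (nu n) \<mu>" for n
    by (rule wasserstein_commute[OF assms(4) P]) simp
  note step = proximal_step[OF assms(1,2) P assms(4) lam_pos assms(10)]
  define a where "a n = 1/2 * (wasserstein 2 (nu n) \<mu>)\<^sup>2" for n
  have W_le: "wasserstein 2 (nu (Suc n)) \<mu> \<le> lam n" for n
    by (rule power2_le_imp_le[OF step(1) less_imp_le[OF lam_pos]])
  have W_nonneg: "0 \<le> wasserstein 2 (nu n) \<mu>" for n
    by (simp add: wasserstein_def)
  have "(\<lambda>n. l0 * (1 / 2) ^ n) \<longlonglongrightarrow> l0 * 0"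
    by (rule tendsto_mult[OF tendsto_const LIMSEQ_power_zero]) simp
  then have "lam \<longlonglongrightarrow> 0"
    unfolding lam[abs_def] by (simp add: power_one_over)
  then have "(\<lambda>n. wasserstein 2 (nu (Suc n)) \<mu>) \<longlonglongrightarrow> 0"
    by (rule tendsto_sandwich[OF always_eventually always_eventually tendsto_const, rotated 2])
      (simp_all add: W_le W_nonneg)
  then have lim: "(\<lambda>n. wasserstein 2 (nu n) \<mu>) \<longlonglongrightarrow> 0"
    by (rule LIMSEQ_imp_Suc)
  have rate: "1/2 * (wasserstein 2 (nu n) \<mu>)\<^sup>2 \<le> 2 powr (- 2 * real n + 1) * (lam 0)\<^sup>2" if n: "n \<ge> 1" for n
  proof -
    obtain m where m: "n = Suc m" using n by (cases n) auto
    have "- 2 * real n + 1 = - real (2 * m + 1)" by (simp add: m)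
    then have "2 powr (- 2 * real n + 1) = inverse (2 ^ (2 * m + 1))"
      by (simp only: powr_minus powr_realpow zero_less_numeral)
    also have "(2::real) ^ (2 * m + 1) = 2 * (2 ^ m)\<^sup>2"
      by (simp add: power_even_eq)
    finally have "2 powr (- 2 * real n + 1) * (lam 0)\<^sup>2 = (lam m)\<^sup>2 / 2"
      by (simp add: lam power_divide inverse_eq_divide)
    then show ?thesis using step(1)[of m] by (simp add: m)
  qed
  have "a \<longlonglongrightarrow> 1/2 * 0\<^sup>2"
    unfolding a_def[abs_def] by (intro tendsto_intros lim)
  then have "(\<lambda>n. a n - a (Suc n)) sums (a 0 - 0)"
    by (intro telescope_sums') simp
  then have "(\<lambda>n. D_lip \<Omega> \<mu> (lam n) (nu n) (nu (Suc n))
              + ereal (lam n * wasserstein 1 (nu n) (nu (Suc n)))) sums ereal (a 0)"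
    unfolding step(2) by (simp only: sums_ereal a_def diff_zero)
  then show ?thesis
    using lim rate by (simp add: comm a_def assms(9))
qed

end
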